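(* Let $0<\alpha<1$ and let $g\ge1$ be a fixed integer. For each $m$ let $n=n(m)\ge g$ and $k=k(m)$ be integers with $n>m$ and $1\le k\le 2^n$. Then almost all $k$-tuples of distributions require $2^{\alpha m(1-o(1))}$ $g$-input gates for approximation by a quantum circuit on the first $m$ qubits to within (average) TVD $2/e-2^{-(1-\alpha)m/2}$. That is, there is a function $\eta(m)\to0$ as $m\to\infty$ such that, with $b(m)=\lfloor 2^{\alpha m(1-\eta(m))}\rfloor$, $$\mu_{\Delta(2^m)^k}\Big(X\big(b(m),g,m,n;2^m,\,2/e-2^{-(1-\alpha)m/2},\,k\big)\Big)\to 0\quad\text{as } m\to\infty.$$
   Context: Probability simplices. $\Delta(N)=\{\mathbf x\in\mathbb R^N: x_i\ge 0 \text{ for all } i,\ \sum_i x_i=1\}$. For a subset $S\subseteq\{1,\dots,N\}$ let $\Delta(S,N)$ be the face $\{\mathbf x\in\Delta(N): x_i=0 \text{ for } i\notin S\}$, and $\Delta(N',N)=\bigcup_{|S|=N'}\Delta(S,N)$, so $\Delta(N,N)=\Delta(N)$. $\Delta(N',N)^k$ is the set of $k$-tuples of members of $\Delta(N',N)$; $\mu_{\Delta(N',N)^k}$ is the uniform probability measure on it, i.e. the Lebesgue measure of the appropriate dimension normalized to total mass 1 (equivalently the $k$-fold product of the measure that chooses $S$ with $|S|=N'$ uniformly and then a uniformly distributed point of $\Delta(S,N)$). For $\mathbf x,\mathbf y\in\Delta(N)$ the total variation distance (TVD) is $|\mathbf x-\mathbf y|_1=\sum_i|x_i-y_i|$; for $k$-tuples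 $\mathbf x=(\mathbf x_1,\dots,\mathbf x_k),\mathbf y=(\mathbf y_1,\dots,\mathbf y_k)\in\Delta(N)^k$ it is the average $|\mathbf x-\mathbf y|_1=\frac1k\sum_{i=1}^k|\mathbf x_i-\mathbf y_i|_1$. Quantum circuits. $H_n=(\mathbb C^2)^{\otimes n}$ with standard orthonormal basis $|b_1b_2\dots b_n\rangle$, $b_i\in\{0,1\}$; for $0\le j<2^n$, $|j\rangle$ denotes the basis vector given by the binary digits of $j$ in reverse order ($j=\sum_i b_i2^{i-1}$). A $g$-input quantum gate is a unitary operator $V$ on $H_g$; applied to a choice of $g$ of the $n$ qubits it acts on $H_n\cong H_g\otimes H_{n-g}$ as $V\otimes I$, the factor $H_g$ corresponding to the chosen qubits. $G_g^{(b,n)}$ is the set of unitary operators on $H_n$ expressible as a composition of at most $b$ $g$-input gates (each with its own choice of $g$ qubits). For a unit vector $|x\rangle\in H_n$ and $m\le n$, $\mathrm{Prob}_m(\cdot\mid|x\rangle)\in\Delta(2^m)$ is the distribution on $m$-bit vectors $c$ given by $\mathrm{Prob}_m(c\mid|x\rangle)=\sum_{c'\in\{0,1\}^{n-m}}|\langle cc'|x\rangle|^2$. For $U$ unitary on $H_n$, $\phi_m(U)\in\Delta(2^m)^k$ is the $k$-tuple $(\mathrm{Prob}_m(\cdot\mid U|0\rangle),\dots,\mathrm{Prob}_m(\cdot\mid U|k-1\rangle))$. $X(b,g,m,n;N,d,k)$ is the set of members of $\Delta(N,2^m)^k$ which are within average TVD $d$ of some element of $\phi_m(G_g^{(b,n)})$.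 *)

theory Defs
  imports "HOL-Probability.Probability" "Jordan_Normal_Form.Schur_Decomposition"
begin

section \<open>Probability simplices and their uniform measures\<close>

text \<open>
  Coordinates are numbered from 0, so a point of \<open>\<real>\<^sup>N\<close> is an extensional function on \<open>{..<N}\<close>
  and a \<open>k\<close>-tuple of such points is an extensional function on \<open>{..<k}\<close>.
\<close>

definition prob_simplex :: "nat \<Rightarrow> (nat \<Rightarrow> real) set" where
  "prob_simplex N = {x \<in> {..<N} \<rightarrow>\<^sub>E UNIV. (\<forall>i<N. 0 \<le> x i) \<and> (\<Sum>i<N. x i) = 1}"

definition simplex_face :: "nat set \<Rightarrow> nat \<Rightarrow> (nat \<Rightarrow> real) set" where
  "simplex_face S N = {x \<in> prob_simplex N. \<forall>i<N. i \<notin> S \<longrightarrow> x i = 0}"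

definition face_index_sets :: "nat \<Rightarrow> nat \<Rightarrow> nat set set" where
  "face_index_sets N' N = {S. S \<subseteq> {..<N} \<and> card S = N'}"

definition sparse_simplex :: "nat \<Rightarrow> nat \<Rightarrow> (nat \<Rightarrow> real) set" where
  "sparse_simplex N' N = (\<Union>S\<in>face_index_sets N' N. simplex_face S N)"

definition sparse_simplex_tuples :: "nat \<Rightarrow> nat \<Rightarrow> nat \<Rightarrow> (nat \<Rightarrow> nat \<Rightarrow> real) set" where
  "sparse_simplex_tuples N' N k = ({..<k} \<rightarrow>\<^sub>E sparse_simplex N' N)"

text \<open>
  The face with index set \<open>S\<close> is parametrized by its coordinates other than \<open>Max S\<close>. The
  parametrization is affine and injective, so it takes the normalized
  \<open>(card S - 1)\<close>-dimensional Lebesgue measure on the parameter domain to the one on the face.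
\<close>

definition face_params :: "nat set \<Rightarrow> (nat \<Rightarrow> real) set" where
  "face_params S = {y \<in> S - {Max S} \<rightarrow>\<^sub>E UNIV.
     (\<forall>i\<in>S - {Max S}. 0 \<le> y i) \<and> (\<Sum>i\<in>S - {Max S}. y i) \<le> 1}"

definition face_point :: "nat set \<Rightarrow> nat \<Rightarrow> (nat \<Rightarrow> real) \<Rightarrow> nat \<Rightarrow> real" where
  "face_point S N y = (\<lambda>i\<in>{..<N}.
     if i \<notin> S then 0
     else if i = Max S then 1 - (\<Sum>j\<in>S - {Max S}. y j)
     else y i)"

definition uniform_face :: "nat set \<Rightarrow> nat \<Rightarrow> (nat \<Rightarrow> real) measure" where
  "uniform_face S N =
     distr (uniform_measure (\<Pi>\<^sub>M i\<in>S - {Max S}. lborel) (face_params S))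
       (\<Pi>\<^sub>M i\<in>{..<N}. borel) (face_point S N)"

definition uniform_sparse_simplex :: "nat \<Rightarrow> nat \<Rightarrow> (nat \<Rightarrow> real) measure" where
  "uniform_sparse_simplex N' N =
     Giry_Monad.bind (uniform_count_measure (face_index_sets N' N)) (\<lambda>S. uniform_face S N)"

definition uniform_sparse_simplex_tuples ::
    "nat \<Rightarrow> nat \<Rightarrow> nat \<Rightarrow> (nat \<Rightarrow> nat \<Rightarrow> real) measure" where
  "uniform_sparse_simplex_tuples N' N k = (\<Pi>\<^sub>M i\<in>{..<k}. uniform_sparse_simplex N' N)"

text \<open>The total variation distance is taken without the factor \<open>1/2\<close>.\<close>

definition tvd :: "nat \<Rightarrow> (nat \<Rightarrow> real) \<Rightarrow> (nat \<Rightarrow> real) \<Rightarrow> real" where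
  "tvd N x y = (\<Sum>i<N. \<bar>x i - y i\<bar>)"

definition avg_tvd :: "nat \<Rightarrow> nat \<Rightarrow> (nat \<Rightarrow> nat \<Rightarrow> real) \<Rightarrow> (nat \<Rightarrow> nat \<Rightarrow> real) \<Rightarrow> real" where
  "avg_tvd N k x y = (\<Sum>i<k. tvd N (x i) (y i)) / real k"


section \<open>Quantum circuits\<close>

text \<open>
  \<open>H\<^sub>n\<close> is the space of complex vectors of dimension \<open>2 ^ n\<close>, with \<open>|j\<rangle>\<close> as its \<open>j\<close>-th
  standard basis vector. Qubits are numbered from 0, and qubit \<open>l\<close> of \<open>|j\<rangle>\<close> is the binary digit
  \<open>bit j l\<close> of weight \<open>2 ^ l\<close>. In particular the first \<open>m\<close> qubits are the \<open>m\<close> least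
  significant digits, and the concatenation of bit vectors \<open>c\<close> and \<open>c'\<close> with \<open>c\<close> of length
  \<open>m\<close> has index \<open>c + 2 ^ m * c'\<close>.
\<close>

definition unitaries :: "nat \<Rightarrow> complex mat set" where
  "unitaries n = {U \<in> carrier_mat (2 ^ n) (2 ^ n).
     mat_adjoint U * U = 1\<^sub>m (2 ^ n) \<and> U * mat_adjoint U = 1\<^sub>m (2 ^ n)}"

text \<open>The basis index of \<open>H\<^bsub>length qs\<^esub>\<close> read off from \<open>|j\<rangle>\<close> at the qubits \<open>qs\<close>.\<close>

definition select_qubits :: "nat list \<Rightarrow> nat \<Rightarrow> nat" where
  "select_qubits qs j = horner_sum of_bool 2 (map (bit j) qs)"

text \<open>\<open>V \<otimes> I\<close>, with input \<open>t\<close> of \<open>V\<close> attached to the qubit \<open>qs ! t\<close>.\<close>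

definition apply_gate :: "nat \<Rightarrow> nat list \<Rightarrow> complex mat \<Rightarrow> complex mat" where
  "apply_gate n qs V = mat (2 ^ n) (2 ^ n) (\<lambda>(i, j).
     if \<forall>l<n. l \<notin> set qs \<longrightarrow> bit i l = bit j l
     then V $$ (select_qubits qs i, select_qubits qs j) else 0)"

definition gates :: "nat \<Rightarrow> nat \<Rightarrow> complex mat set" where
  "gates g n = {apply_gate n qs V | qs V.
     distinct qs \<and> length qs = g \<and> set qs \<subseteq> {..<n} \<and> V \<in> unitaries g}"

definition circuits :: "nat \<Rightarrow> nat \<Rightarrow> nat \<Rightarrow> complex mat set" where
  "circuits g b n = {foldr (*) Us (1\<^sub>m (2 ^ n)) | Us. length Us \<le> b \<and> set Us \<subseteq> gates g n}"

definition outcome_prob :: "nat \<Rightarrow> nat \<Rightarrow> complex vec \<Rightarrow> nat \<Rightarrow> real" where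
  "outcome_prob m n x = (\<lambda>c\<in>{..<2 ^ m}. \<Sum>c'<2 ^ (n - m). (cmod (vec_index x (c + 2 ^ m * c')))\<^sup>2)"

definition outcome_tuple :: "nat \<Rightarrow> nat \<Rightarrow> nat \<Rightarrow> complex mat \<Rightarrow> nat \<Rightarrow> nat \<Rightarrow> real" where
  "outcome_tuple m n k U = (\<lambda>i\<in>{..<k}. outcome_prob m n (U *\<^sub>v unit_vec (2 ^ n) i))"

definition approximable ::
    "nat \<Rightarrow> nat \<Rightarrow> nat \<Rightarrow> nat \<Rightarrow> nat \<Rightarrow> real \<Rightarrow> nat \<Rightarrow> (nat \<Rightarrow> nat \<Rightarrow> real) set" where
  "approximable b g m n N d k = {x \<in> sparse_simplex_tuples N (2 ^ m) k.
     \<exists>y \<in> outcome_tuple m n k ` circuits g b n. avg_tvd (2 ^ m) k x y \<le> d}"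

end

theory Submission
  imports Defs "HOL-Real_Asymp.Real_Asymp"
begin

text \<open>
  Write \<open>N = 2 ^ m\<close>. For a fixed target \<open>y\<close>, the \<open>N\<close> coordinates of a uniform point of the simplex
  behave like independent exponential variables of mean \<open>1 / N\<close>, and \<open>E \<bar>X - a\<bar> = a - 1 + 2 exp (- a)\<close>
  for a standard exponential variable is convex in \<open>a\<close> with value \<open>2 / e\<close> at \<open>a = 1\<close>. A Chernoff bound
  shows that a random \<open>k\<close>-tuple is within \<open>2 / e - \<epsilon>\<close> of \<open>y\<close> with probability at most
  \<open>(e\<^sup>2 N exp (- N \<epsilon>\<^sup>2 / 12)) ^ k\<close>. With \<open>\<epsilon>\<close> of order \<open>N powr (- (1 - \<alpha>) / 2)\<close> the exponent is of order
  \<open>k N powr \<alpha>\<close>. On the other side, the outputs of circuits with \<open>b\<close> gates have a net of size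
  \<open>exp (O (b m k))\<close>: the entries of the gates are discretized, and since the initial states \<open>|j\<rangle>\<close> with
  \<open>j < k\<close> are \<open>0\<close> on all qubits from \<open>k\<close> on, the qubits outside the first \<open>m + k\<close> can be permuted
  so that only \<open>m + k + g b\<close> of them are used, however large \<open>n\<close> is. The union bound over the net
  tends to \<open>0\<close> as soon as \<open>b m\<close> is small compared to \<open>N powr \<alpha>\<close>.
\<close>

section \<open>Chernoff bound on the simplex\<close>

text \<open>Stirling-type bound n! \<le> e n (n/e)^n. The induction step amounts to e \<le> (1 +
  1/n)^(n+1), which is ln x \<le> x - 1 at x = n/(n+1). It later absorbs the factor (N-1)! coming
  from the volume of the simplex.\<close>

lemma fact_mult_exp_le:
  assumes "1 \<le> n"
  shows "fact n * exp (real n) \<le> exp 1 * real n * real n ^ n"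
  using assms
proof (induction n rule: dec_induct)
  case base
  show ?case by simp
next
  case (step n)
  then have n: "0 < real n" by simp
  have "ln (real n / (real n + 1)) \<le> real n / (real n + 1) - 1"
    using n by (intro ln_le_minus_one) simp
  also have "\<dots> = - (1 / (real n + 1))"
    using n by (simp add: field_simps)
  finally have "1 \<le> (real n + 1) * (ln (real n + 1) - ln (real n))"
    using n by (simp add: ln_div field_simps)
  also have "\<dots> = ln (((real n + 1) / real n) ^ (n + 1))"
    using n by (subst ln_realpow) (simp_all add: ln_div add.commute)
  finally have "exp 1 \<le> ((real n + 1) / real n) ^ (n + 1)"
    using n by (subst (asm) ln_ge_iff) auto
  then have e: "exp 1 * real n * real n ^ n \<le> (real n + 1) ^ (n + 1)"
    using n by (simp add: power_divide field_simps)
  have "fact (Suc n) * exp (real (Suc n)) = (real n + 1) * exp 1 * (fact n * exp (real n))"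
    by (simp add: exp_add algebra_simps)
  also have "\<dots> \<le> (real n + 1) * exp 1 * (exp 1 * real n * real n ^ n)"
    using step.IH by (intro mult_left_mono) auto
  also have "\<dots> \<le> (real n + 1) * exp 1 * (real n + 1) ^ (n + 1)"
    using e by (intro mult_left_mono) auto
  finally show ?case by (simp add: algebra_simps)
qed

text \<open>\<open>(exp (- \<mu> a) - exp (- a)) / (1 - \<mu>) + exp (- a) / (1 + \<mu>)\<close> is \<open>E exp (- \<mu> \<bar>X - a\<bar>)\<close>
  for a standard exponential variable \<open>X\<close>, and \<open>2 / e + (1 - 2 / e) (a - 1)\<close> is the tangent
  at \<open>a = 1\<close> of the convex function \<open>a \<mapsto> E \<bar>X - a\<bar>\<close>.\<close>
lemma exponential_moment_le:
  fixes \<mu> a :: real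
  assumes "0 \<le> \<mu>" "\<mu> \<le> 1/2" "0 \<le> a"
  shows "(exp (- \<mu> * a) - exp (- a)) / (1 - \<mu>) + exp (- a) / (1 + \<mu>)
    \<le> exp (- \<mu> * (2 / exp 1 + (1 - 2 / exp 1) * (a - 1)) + 3 * \<mu>\<^sup>2)"
proof -
  define h where "h = 2 / exp 1 + (1 - 2 / exp 1) * (a - 1)"
  have mu2: "\<mu>\<^sup>2 \<le> 1/4"
    using power_mono[OF assms(2,1), of 2] by (simp add: power2_eq_square)
  have "1 \<le> (1 - \<mu>\<^sup>2) * (1 + 2 * \<mu>\<^sup>2)"
    using mu2 zero_le_power2[of \<mu>] mult_nonneg_nonneg[of "\<mu>\<^sup>2" "1 - 2 * \<mu>\<^sup>2"]
    by (simp add: algebra_simps)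
  also have "\<dots> \<le> (1 - \<mu>\<^sup>2) * exp (2 * \<mu>\<^sup>2)"
    using mu2 by (intro mult_left_mono exp_ge_add_one_self) auto
  finally have inv: "1 / (1 - \<mu>\<^sup>2) \<le> exp (2 * \<mu>\<^sup>2)"
    using mu2 by (simp add: field_simps)
  have eq: "(exp (- \<mu> * a) - exp (- a)) / (1 - \<mu>) + exp (- a) / (1 + \<mu>)
      = ((1 + \<mu>) * exp (- \<mu> * a) - 2 * \<mu> * exp (- a)) * (1 / (1 - \<mu>\<^sup>2))"
    using assms mu2 by (simp add: divide_simps power2_eq_square) (simp add: algebra_simps)
  \<comment> \<open>For a \<le> 2 both sides are compared to second order in \<mu>; the remainder is
    controlled because a (2 - a) \<ge> 0 and \<mu> a^2 \<le> 2. For a > 2 the tangent value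
    \<open>h\<close> is at most a - 1, and 1 + \<mu> \<le> exp \<mu> suffices once the negative term
    is dropped.\<close>
  have main: "(1 + \<mu>) * exp (- \<mu> * a) - 2 * \<mu> * exp (- a) \<le> exp (- \<mu> * h + \<mu>\<^sup>2)"
  proof (cases "a \<le> 2")
    case True
    define z where "z = \<mu> * a"
    have z: "0 \<le> z" using assms by (simp add: z_def)
    \<comment> \<open>The quadratic Taylor polynomials of exp (- z) and exp z have product 1 +
      z^4/4, so the lower bound for exp z yields an upper bound for exp (- z).\<close>
    have "1 \<le> (1 - z + z\<^sup>2 / 2) * (1 + z + z\<^sup>2 / 2)"
    proof -
      have "(1 - z + z\<^sup>2 / 2) * (1 + z + z\<^sup>2 / 2) = 1 + (z\<^sup>2)\<^sup>2 / 4"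
        by (simp add: algebra_simps power2_eq_square)
      then show ?thesis by simp
    qed
    also have "\<dots> \<le> (1 - z + z\<^sup>2 / 2) * exp z"
    proof (rule mult_left_mono[OF exp_lower_Taylor_quadratic[OF z]])
      have "1 - z + z\<^sup>2 / 2 = ((1 - z)\<^sup>2 + 1) / 2"
        by (simp add: algebra_simps power2_eq_square)
      then show "0 \<le> 1 - z + z\<^sup>2 / 2"
        by (metis add_nonneg_nonneg divide_nonneg_nonneg zero_le_numeral zero_le_one zero_le_power2)
    qed
    finally have "exp (- z) \<le> 1 - z + z\<^sup>2 / 2"
      by (simp add: exp_minus field_simps)
    then have "(1 + \<mu>) * exp (- z) \<le> (1 + \<mu>) * (1 - z + z\<^sup>2 / 2)"
      using assms by (intro mult_left_mono) auto
    also have "\<dots> = 1 + \<mu> - \<mu> * a - \<mu>\<^sup>2 * (a * (2 - a) / 2) + \<mu>\<^sup>2 * (\<mu> * a\<^sup>2 / 2)"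
      by (simp add: z_def field_simps power2_eq_square)
    also have "\<dots> \<le> 1 + \<mu> - \<mu> * a - \<mu>\<^sup>2 * 0 + \<mu>\<^sup>2 * 1"
    proof (intro add_mono diff_mono mult_left_mono order_refl zero_le_power2)
      have "a\<^sup>2 \<le> 4" using power_mono[OF True assms(3), of 2] by simp
      then have "\<mu> * a\<^sup>2 \<le> 1/2 * 4" using assms by (intro mult_mono) auto
      then show "\<mu> * a\<^sup>2 / 2 \<le> 1" by simp
      show "0 \<le> a * (2 - a) / 2" "0 \<le> \<mu>" using assms True by auto
    qed
    finally have "(1 + \<mu>) * exp (- \<mu> * a) \<le> 1 + \<mu> - \<mu> * a + \<mu>\<^sup>2"
      by (simp add: z_def)
    \<comment> \<open>The tangent of exp (- a) at a = 1 supplies the affine part of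
      \<open>h\<close>.\<close>
    moreover have "2 * \<mu> * (exp (- 1) * (2 - a)) \<le> 2 * \<mu> * exp (- a)"
    proof (rule mult_left_mono)
      have "exp (- 1) * (1 + (1 - a)) \<le> exp (- 1) * exp (1 - a)"
        by (intro mult_left_mono exp_ge_add_one_self) auto
      then show "exp (- 1) * (2 - a) \<le> exp (- a)"
        by (simp flip: exp_add)
    qed (use assms in auto)
    moreover have "\<mu> * h = \<mu> * a - \<mu> + 2 * \<mu> * (exp (- 1) * (2 - a))"
      by (simp add: h_def exp_minus field_simps)
    ultimately have "(1 + \<mu>) * exp (- \<mu> * a) - 2 * \<mu> * exp (- a) \<le> 1 + (- \<mu> * h + \<mu>\<^sup>2)"
      by linarith
    also have "\<dots> \<le> exp (- \<mu> * h + \<mu>\<^sup>2)" by (rule exp_ge_add_one_self)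
    finally show ?thesis .
  next
    case False
    have "(1 + \<mu>) * exp (- \<mu> * a) \<le> exp \<mu> * exp (- \<mu> * a)"
      by (intro mult_right_mono exp_ge_add_one_self) auto
    also have "\<dots> = exp (- \<mu> * (a - 1))"
      by (simp add: algebra_simps flip: exp_add)
    also have "\<dots> \<le> exp (- \<mu> * h + \<mu>\<^sup>2)"
    proof -
      have "h = (a - 1) - 2 / exp 1 * (a - 2)" by (simp add: h_def field_simps)
      moreover have "0 \<le> 2 / exp 1 * (a - 2)" using False by (intro mult_nonneg_nonneg) auto
      ultimately have "h \<le> a - 1" by linarith
      then have "\<mu> * h \<le> \<mu> * (a - 1)" using assms by (intro mult_left_mono) auto
      moreover note zero_le_power2[of \<mu>]
      ultimately have "- \<mu> * (a - 1) \<le> - \<mu> * h + \<mu>\<^sup>2" by linarith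
      then show ?thesis by simp
    qed
    finally show ?thesis using assms by (smt (verit) exp_gt_zero mult_nonneg_nonneg)
  qed
  have "(exp (- \<mu> * a) - exp (- a)) / (1 - \<mu>) + exp (- a) / (1 + \<mu>)
      \<le> exp (- \<mu> * h + \<mu>\<^sup>2) * (1 / (1 - \<mu>\<^sup>2))"
    unfolding eq using mu2 by (intro mult_right_mono[OF main]) auto
  also have "\<dots> \<le> exp (- \<mu> * h + \<mu>\<^sup>2) * exp (2 * \<mu>\<^sup>2)"
    by (intro mult_left_mono[OF inv]) auto
  also have "\<dots> = exp (- \<mu> * h + 3 * \<mu>\<^sup>2)"
    by (simp flip: exp_add)
  finally show ?thesis by (simp add: h_def)
qed

text \<open>Splitting at t = y, where the absolute value changes sign, leaves two plain exponential
  integrals: rate p - l on [0, y] and rate p + l beyond y. For p = n and l = n \<mu> the result is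
  the moment of \<open>exponential_moment_le\<close> at a = n y, divided by n.\<close>

lemma nn_integral_laplace_kernel:
  fixes p l y :: real
  assumes "0 \<le> l" "l < p" "0 \<le> y"
  shows "(\<integral>\<^sup>+t. ennreal (exp (- p * t - l * \<bar>t - y\<bar>)) * indicator {0..} t \<partial>lborel)
    = ennreal ((exp (- l * y) - exp (- p * y)) / (p - l) + exp (- p * y) / (p + l))"
proof -
  let ?f = "\<lambda>t. exp (- p * t - l * \<bar>t - y\<bar>)"
  have p: "0 < p" "0 < p - l" "0 < p + l" using assms by auto
  have deriv: "((\<lambda>t. - exp (a - c * t) / c) has_real_derivative exp (a - c * t)) (at t)"
    if "c \<noteq> 0" for a c t :: real
    using that by (auto intro!: derivative_eq_intros)
  have "(\<integral>\<^sup>+t. ennreal (?f t) * indicator {0..} t \<partial>lborel)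
      = (\<integral>\<^sup>+t. ennreal (exp (- l * y - (p - l) * t)) * indicator {0..y} t
          + ennreal (exp (l * y - (p + l) * t)) * indicator {y..} t \<partial>lborel)"
  \<comment> \<open>The two closed pieces overlap at t = y, so the integrands agree only almost
    everywhere.\<close>
  proof (rule nn_integral_cong_AE)
    show "AE t in lborel. ennreal (?f t) * indicator {0..} t
        = ennreal (exp (- l * y - (p - l) * t)) * indicator {0..y} t
          + ennreal (exp (l * y - (p + l) * t)) * indicator {y..} t"
      using AE_lborel_singleton[of y]
    proof eventually_elim
      case (elim t)
      then consider "t < y" | "y < t" by linarith
      then show ?case
        using assms by cases (auto simp: indicator_def algebra_simps)
    qed
  qed
  also have "\<dots> = (\<integral>\<^sup>+t. ennreal (exp (- l * y - (p - l) * t)) * indicator {0..y} t \<partial>lborel)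
      + (\<integral>\<^sup>+t. ennreal (exp (l * y - (p + l) * t)) * indicator {y..} t \<partial>lborel)"
    by (intro nn_integral_add) auto
  also have "(\<integral>\<^sup>+t. ennreal (exp (- l * y - (p - l) * t)) * indicator {0..y} t \<partial>lborel)
      = ennreal (- exp (- l * y - (p - l) * y) / (p - l) - - exp (- l * y - (p - l) * 0) / (p - l))"
    using p assms by (intro nn_integral_FTC_Icc deriv) auto
  also have "\<dots> = ennreal ((exp (- l * y) - exp (- p * y)) / (p - l))"
    by (simp add: diff_divide_distrib left_diff_distrib)
  also have "(\<integral>\<^sup>+t. ennreal (exp (l * y - (p + l) * t)) * indicator {y..} t \<partial>lborel)
      = ennreal (0 - - exp (l * y - (p + l) * y) / (p + l))"
  proof (rule nn_integral_FTC_atLeast[where F = "\<lambda>t. - exp (l * y - (p + l) * t) / (p + l)"])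
    show "((\<lambda>t. - exp (l * y - (p + l) * t) / (p + l)) \<longlongrightarrow> 0) at_top"
      using p(3) by real_asymp
    show "((\<lambda>t. - exp (l * y - (p + l) * t) / (p + l)) has_real_derivative exp (l * y - (p + l) * t)) (at t)" for t
      using p(3) by (intro deriv) simp
  qed auto
  also have "\<dots> = ennreal (exp (- p * y) / (p + l))"
    by (simp add: algebra_simps)
  also have "ennreal ((exp (- l * y) - exp (- p * y)) / (p - l)) + ennreal (exp (- p * y) / (p + l))
      = ennreal ((exp (- l * y) - exp (- p * y)) / (p - l) + exp (- p * y) / (p + l))"
    using p assms by (intro ennreal_plus[symmetric]) (auto intro!: divide_nonneg_nonneg mult_right_mono)
  finally show ?thesis .
qed

section \<open>The uniform measure on a face and on the full simplex\<close>

lemma measurable_face_params: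
  assumes "finite S"
  shows "face_params S \<in> sets (\<Pi>\<^sub>M i\<in>S - {Max S}. lborel)"
proof -
  let ?M = "\<Pi>\<^sub>M i\<in>S - {Max S}. lborel :: real measure"
  have "face_params S = Pi\<^sub>E (S - {Max S}) (\<lambda>_. {0..}) \<inter>
      (\<lambda>x. sum x (S - {Max S})) -` {..1} \<inter> space ?M"
    by (auto simp: face_params_def space_PiM)
  also have "\<dots> \<in> sets ?M"
    using finite_Diff[OF assms, of "{Max S}"] by measurable
  finally show ?thesis .
qed

lemma emeasure_face_params:
  assumes "finite S"
  shows "emeasure (\<Pi>\<^sub>M i\<in>S - {Max S}. lborel) (face_params S)
    = ennreal (1 / fact (card (S - {Max S})))"
proof -
  have "face_params S = {x. (\<forall>i\<in>S - {Max S}. 0 \<le> x i) \<and> sum x (S - {Max S}) \<le> 1} \<inter>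
      space (\<Pi>\<^sub>M i\<in>S - {Max S}. lborel)"
    by (auto simp: face_params_def space_PiM)
  then show ?thesis
    using assms by (simp add: emeasure_std_simplex_aux)
qed

lemma measurable_face_point:
  "face_point S N \<in> measurable (\<Pi>\<^sub>M i\<in>S - {Max S}. lborel) (\<Pi>\<^sub>M i\<in>{..<N}. borel)"
  unfolding face_point_def
proof (rule measurable_restrict)
  fix i assume "i \<in> {..<N}"
  show "(\<lambda>y. if i \<notin> S then 0 else if i = Max S then 1 - (\<Sum>j\<in>S - {Max S}. y j) else y i)
      \<in> borel_measurable (\<Pi>\<^sub>M i\<in>S - {Max S}. lborel)"
    by (cases "i \<in> S"; cases "i = Max S") auto
qed

lemma prob_space_uniform_face:
  assumes "finite S"
  shows "prob_space (uniform_face S N)"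
  unfolding uniform_face_def
proof (rule prob_space.prob_space_distr)
  show "prob_space (uniform_measure (\<Pi>\<^sub>M i\<in>S - {Max S}. lborel) (face_params S))"
    using emeasure_face_params[OF assms] by (intro prob_space_uniform_measure) auto
  show "face_point S N \<in> measurable
      (uniform_measure (\<Pi>\<^sub>M i\<in>S - {Max S}. lborel) (face_params S)) (\<Pi>\<^sub>M i\<in>{..<N}. borel)"
    using measurable_face_point by (simp cong: measurable_cong_sets)
qed

lemma sets_uniform_face [measurable_cong]: "sets (uniform_face S N) = sets (\<Pi>\<^sub>M i\<in>{..<N}. borel)"
  by (simp add: uniform_face_def)

text \<open>There is only one index set of full size, so the mixture over faces is a bind from a
  point mass.\<close>

lemma uniform_sparse_simplex_full:
  "uniform_sparse_simplex N N = uniform_face {..<N} N"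
proof -
  have "face_index_sets N N = {{..<N}}"
    by (auto simp: face_index_sets_def dest: card_subset_eq[rotated])
  moreover have "uniform_count_measure {{..<N}} = return (count_space {{..<N}}) {..<N}"
    by (rule measure_eqI)
       (auto simp: emeasure_uniform_count_measure_if sets_uniform_count_measure indicator_def
         subset_singleton_iff)
  ultimately have "uniform_sparse_simplex N N
      = return (count_space {{..<N}}) {..<N} \<bind> (\<lambda>S. uniform_face S N)"
    by (simp add: uniform_sparse_simplex_def)
  also have "\<dots> = uniform_face {..<N} N"
    by (rule bind_return[where N = "\<Pi>\<^sub>M i\<in>{..<N}. borel"])
       (auto simp: space_subprob_algebra sets_uniform_face
         intro!: prob_space_imp_subprob_space prob_space_uniform_face)
  finally show ?thesis .
qed

section \<open>Exponential moments of the distance to a fixed target\<close>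

lemma measurable_tvd [measurable]:
  "(\<lambda>x. tvd N x y) \<in> borel_measurable (\<Pi>\<^sub>M i\<in>{..<N}. borel)"
  unfolding tvd_def by (rule borel_measurable_sum) measurable

text \<open>The indicator function of the simplex is dominated by an exponential in the last coordinate
  \<open>x\<^sub>l = 1 - (\<Sum>i. x i)\<close>, which turns the integral into a product of one-dimensional ones.\<close>
lemma nn_integral_exp_tvd_le:
  assumes N: "1 \<le> N" and \<mu>: "0 \<le> \<mu>" "\<mu> \<le> 1/2" and y: "y \<in> prob_simplex N"
  shows "(\<integral>\<^sup>+x. ennreal (exp (- (real N * \<mu>) * tvd N x y)) \<partial>uniform_face {..<N} N)
    \<le> ennreal (exp 2 * real N * exp (real N * (3 * \<mu>\<^sup>2 - \<mu> * (2 / exp 1))))"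
proof -
  define l where "l = N - 1"
  have Suc: "N = Suc l" using N by (simp add: l_def)
  have Max: "Max {..<N} = l" using Max_eqI[of "{..<N}" l] by (auto simp: Suc)
  have l: "{..<N} - {l} = {..<l}" by (auto simp: Suc)
  then have diff: "{..<N} - {Max {..<N}} = {..<l}" unfolding Max .
  define M where "M = (\<Pi>\<^sub>M i\<in>{..<l}. lborel :: real measure)"
  define P where "P = face_params {..<N}"
  define n where "n = real N"
  \<comment> \<open>The slope at a = 1 of the convex function a \<mapsto> E |X - a|.\<close>
  define c where "c = 1 - 2 / exp (1::real)"
  have n: "0 < n" using N by (simp add: n_def)
  have e2: "(2::real) \<le> exp 1" using exp_ge_add_one_self[of 1] by simp
  have c: "0 \<le> c" "c \<le> 1" using e2 by (simp_all add: c_def)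
  have P_sets [measurable]: "P \<in> sets M"
    using measurable_face_params[of "{..<N}"] unfolding diff by (simp add: P_def M_def)
  have P_emeasure: "emeasure M P = ennreal (1 / fact l)"
    using emeasure_face_params[of "{..<N}"] unfolding diff by (simp add: P_def M_def)
  have fp [measurable]: "face_point {..<N} N \<in> measurable M (\<Pi>\<^sub>M i\<in>{..<N}. borel)"
    using measurable_face_point[of "{..<N}" N] unfolding diff by (simp add: M_def)
  have y0: "0 \<le> y i" if "i < N" for i
    using y that by (auto simp: prob_simplex_def)
  have y1: "y l + (\<Sum>i<l. y i) = 1"
    using y by (simp add: prob_simplex_def Suc add.commute)
  have face_point: "face_point {..<N} N z i = (if i = l then 1 - (\<Sum>j<l. z j) else z i)"
    if "i < N" for z i
    using that unfolding face_point_def diff Max by (simp add: l)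
  interpret product_sigma_finite "\<lambda>_::nat. lborel :: real measure" by standard
  let ?k = "\<lambda>i t. ennreal (exp (- n * t - n * \<mu> * \<bar>t - y i\<bar>)) * indicator {0..} t"
  let ?g = "\<lambda>i. exp (- \<mu> * (2 / exp 1 + c * (n * y i - 1)) + 3 * \<mu>\<^sup>2) / n"

  \<comment> \<open>The last coordinate is x = 1 - \<Sum> z i, so exp (n x) = exp (n - n * \<Sum> z
    i) provides an exponential weight of rate n for each of the l free coordinates. The factor exp
    (- n \<mu> c y l) is kept because it cancels a term of the product bound at the end.\<close>
  have pointwise: "ennreal (exp (- (n * \<mu>) * tvd N (face_point {..<N} N z) y)) * indicator P z
      \<le> ennreal (exp (n - n * \<mu> * c * y l)) * (\<Prod>i<l. ?k i (z i))" for z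
  proof (cases "z \<in> P")
    case True
    then have z0: "\<And>i. i < l \<Longrightarrow> 0 \<le> z i" and z1: "(\<Sum>i<l. z i) \<le> 1"
      unfolding P_def face_params_def diff by auto
    define x where "x = 1 - (\<Sum>i<l. z i)"
    have "tvd N (face_point {..<N} N z) y = \<bar>x - y l\<bar> + (\<Sum>i<l. \<bar>z i - y i\<bar>)"
      by (simp add: tvd_def Suc face_point[unfolded Suc] x_def)
    \<comment> \<open>First |x - y l| is bounded below by c (y l - x), using 0 \<le> c \<le> 1; then
      \<mu> c x is bounded by x, using x \<ge> 0 and \<mu> c \<le> 1/2.\<close>
    moreover have "n * \<mu> * c * y l - n * x \<le> n * \<mu> * \<bar>x - y l\<bar>"
    proof -
      have "c * (y l - x) \<le> \<bar>x - y l\<bar>"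
        using c mult_left_le_one_le[of "\<bar>x - y l\<bar>" c] mult_left_mono[of "y l - x" "\<bar>x - y l\<bar>" c]
        by linarith
      then have "n * \<mu> * (c * (y l - x)) \<le> n * \<mu> * \<bar>x - y l\<bar>"
        using \<mu> n by (intro mult_left_mono) auto
      moreover have "\<mu> * c \<le> 1/2 * 1" using \<mu> c by (intro mult_mono) auto
      then have "n * x * (\<mu> * c) \<le> n * x"
        using n z1 by (intro mult_left_le) (auto simp: x_def)
      ultimately show ?thesis by (simp add: algebra_simps)
    qed
    ultimately have "- (n * \<mu>) * tvd N (face_point {..<N} N z) y
        \<le> n - n * \<mu> * c * y l + (\<Sum>i<l. - n * z i - n * \<mu> * \<bar>z i - y i\<bar>)"
      by (simp add: x_def sum_subtractf sum_negf algebra_simps flip: sum_distrib_left)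
    then have "exp (- (n * \<mu>) * tvd N (face_point {..<N} N z) y)
        \<le> exp (n - n * \<mu> * c * y l) * (\<Prod>i<l. exp (- n * z i - n * \<mu> * \<bar>z i - y i\<bar>))"
      by (simp flip: exp_sum exp_add)
    then have "ennreal (exp (- (n * \<mu>) * tvd N (face_point {..<N} N z) y))
        \<le> ennreal (exp (n - n * \<mu> * c * y l) * (\<Prod>i<l. exp (- n * z i - n * \<mu> * \<bar>z i - y i\<bar>)))"
      by (rule ennreal_leI)
    also have "\<dots> = ennreal (exp (n - n * \<mu> * c * y l)) *
        (\<Prod>i<l. ennreal (exp (- n * z i - n * \<mu> * \<bar>z i - y i\<bar>)))"
      by (simp add: ennreal_mult prod_nonneg flip: prod_ennreal)
    also have "(\<Prod>i<l. ennreal (exp (- n * z i - n * \<mu> * \<bar>z i - y i\<bar>))) = (\<Prod>i<l. ?k i (z i))"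
      using z0 by (intro prod.cong) auto
    finally show ?thesis using True by simp
  qed simp

  have "(\<integral>\<^sup>+t. ?k i t \<partial>lborel) \<le> ennreal (?g i)" if "i < l" for i
  proof -
    have "n * \<mu> < n" using \<mu> n by simp
    then have "(\<integral>\<^sup>+t. ?k i t \<partial>lborel) = ennreal ((exp (- (n * \<mu>) * y i) - exp (- n * y i)) / (n - n * \<mu>)
        + exp (- n * y i) / (n + n * \<mu>))"
      using \<mu> n y0[of i] that by (intro nn_integral_laplace_kernel) (auto simp: Suc)
    also have "(exp (- (n * \<mu>) * y i) - exp (- n * y i)) / (n - n * \<mu>) + exp (- n * y i) / (n + n * \<mu>)
        = ((exp (- \<mu> * (n * y i)) - exp (- (n * y i))) / (1 - \<mu>) + exp (- (n * y i)) / (1 + \<mu>)) / n"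
    proof -
      have "n - n * \<mu> = (1 - \<mu>) * n" "n + n * \<mu> = (1 + \<mu>) * n"
        by (simp_all add: algebra_simps)
      then show ?thesis by (simp add: add_divide_distrib mult.commute mult.left_commute)
    qed
    also have "\<dots> \<le> ?g i"
      using n \<mu> y0[of i] that unfolding c_def
      by (intro divide_right_mono exponential_moment_le) (auto simp: Suc)
    finally show ?thesis by (simp add: ennreal_leI)
  qed
  then have "(\<Prod>i<l. \<integral>\<^sup>+t. ?k i t \<partial>lborel) \<le> (\<Prod>i<l. ennreal (?g i))"
    by (intro prod_mono_ennreal) auto
  also have "\<dots> = ennreal (\<Prod>i<l. ?g i)"
    using n by (intro prod_ennreal) auto
  finally have prod_le: "(\<Prod>i<l. \<integral>\<^sup>+t. ?k i t \<partial>lborel) \<le> ennreal (\<Prod>i<l. ?g i)" .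

  have "(\<integral>\<^sup>+x. ennreal (exp (- (real N * \<mu>) * tvd N x y)) \<partial>uniform_face {..<N} N)
      = (\<integral>\<^sup>+z. ennreal (exp (- (n * \<mu>) * tvd N (face_point {..<N} N z) y)) \<partial>uniform_measure M P)"
    unfolding uniform_face_def diff P_def[symmetric] M_def[symmetric] n_def
    by (subst nn_integral_distr) auto
  also have "\<dots> = (\<integral>\<^sup>+z. ennreal (exp (- (n * \<mu>) * tvd N (face_point {..<N} N z) y)) * indicator P z \<partial>M)
      / emeasure M P"
    by (intro nn_integral_uniform_measure) auto
  also have "\<dots> \<le> (\<integral>\<^sup>+z. ennreal (exp (n - n * \<mu> * c * y l)) * (\<Prod>i<l. ?k i (z i)) \<partial>M) / emeasure M P"
    by (intro divide_right_mono_ennreal nn_integral_mono pointwise)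
  also have "(\<integral>\<^sup>+z. ennreal (exp (n - n * \<mu> * c * y l)) * (\<Prod>i<l. ?k i (z i)) \<partial>M)
      = ennreal (exp (n - n * \<mu> * c * y l)) * (\<integral>\<^sup>+z. (\<Prod>i<l. ?k i (z i)) \<partial>M)"
    unfolding M_def by (rule nn_integral_cmult) measurable
  also have "(\<integral>\<^sup>+z. (\<Prod>i<l. ?k i (z i)) \<partial>M) = (\<Prod>i<l. \<integral>\<^sup>+t. ?k i t \<partial>lborel)"
    unfolding M_def by (rule product_nn_integral_prod) measurable
  also have "ennreal (exp (n - n * \<mu> * c * y l)) * \<dots> / emeasure M P
      \<le> ennreal (exp (n - n * \<mu> * c * y l)) * ennreal (\<Prod>i<l. ?g i) / emeasure M P"
    by (intro divide_right_mono_ennreal mult_left_mono prod_le) auto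
  also have "\<dots> = ennreal (exp (n - n * \<mu> * c * y l) * (\<Prod>i<l. ?g i) * fact l)"
    unfolding P_emeasure using n
    by (subst ennreal_mult[symmetric]; (subst divide_ennreal)?) (auto intro!: prod_nonneg mult_nonneg_nonneg)
  also have "\<dots> \<le> ennreal (exp 2 * real N * exp (real N * (3 * \<mu>\<^sup>2 - \<mu> * (2 / exp 1))))"
  proof (rule ennreal_leI)
    \<comment> \<open>The tangent bound is affine in y i, so only the sum of the y i, namely 1 - y
      l, enters. The surviving term n \<mu> c y l cancels against the prefactor, which makes the
      final bound uniform in the target.\<close>
    have "(\<Sum>i<l. - \<mu> * (2 / exp 1 + c * (n * y i - 1)) + 3 * \<mu>\<^sup>2)
        = (\<Sum>i<l. (3 * \<mu>\<^sup>2 - \<mu> * (2 / exp 1) + \<mu> * c) - \<mu> * c * n * y i)"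
      by (simp add: algebra_simps)
    also have "\<dots> = real l * (3 * \<mu>\<^sup>2 - \<mu> * (2 / exp 1) + \<mu> * c) - \<mu> * c * n * (\<Sum>i<l. y i)"
      by (simp only: sum_subtractf sum_constant card_lessThan sum_distrib_left)
    also have "(\<Sum>i<l. y i) = 1 - y l" using y1 by simp
    also have "real l = n - 1" by (simp add: n_def Suc)
    also have "(n - 1) * (3 * \<mu>\<^sup>2 - \<mu> * (2 / exp 1) + \<mu> * c) - \<mu> * c * n * (1 - y l) = n * (3 * \<mu>\<^sup>2 - \<mu> * (2 / exp 1)) + n * \<mu> * c * y l + (\<mu> * (2 / exp 1 - c) - 3 * \<mu>\<^sup>2)"
      by (simp add: algebra_simps diff_divide_distrib)
    finally have sum: "(\<Sum>i<l. - \<mu> * (2 / exp 1 + c * (n * y i - 1)) + 3 * \<mu>\<^sup>2) = \<dots>" .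
    have "(\<Prod>i<l. ?g i) = exp (\<Sum>i<l. - \<mu> * (2 / exp 1 + c * (n * y i - 1)) + 3 * \<mu>\<^sup>2) / n ^ l"
      by (simp add: prod_dividef exp_sum)
    then have "exp (n - n * \<mu> * c * y l) * (\<Prod>i<l. ?g i) * fact l
        = exp (\<mu> * (2 / exp 1 - c) - 3 * \<mu>\<^sup>2) * (fact l * exp n / n ^ l)
          * exp (n * (3 * \<mu>\<^sup>2 - \<mu> * (2 / exp 1)))"
      unfolding sum by (simp add: field_simps flip: exp_add)
    also have "\<dots> \<le> exp 1 * (exp 1 * n) * exp (n * (3 * \<mu>\<^sup>2 - \<mu> * (2 / exp 1)))"
    proof (intro mult_right_mono mult_mono)
      have "2 / exp 1 - c \<le> 1" using e2 by (simp add: c_def field_simps)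
      then have "\<mu> * (2 / exp 1 - c) \<le> \<mu> * 1" using \<mu> by (intro mult_left_mono) auto
      then have "\<mu> * (2 / exp 1 - c) - 3 * \<mu>\<^sup>2 \<le> 1"
        using \<mu> zero_le_power2[of \<mu>] by linarith
      then show "exp (\<mu> * (2 / exp 1 - c) - 3 * \<mu>\<^sup>2) \<le> exp 1" by simp
      \<comment> \<open>As N = l + 1, numerator and denominator are both multiplied by N to reach
        the Stirling form.\<close>
      have "fact l * exp n / n ^ l = fact N * exp n / n ^ N"
        using n by (simp add: Suc n_def)
      also have "\<dots> \<le> exp 1 * n"
        using fact_mult_exp_le[OF N] n by (simp add: n_def pos_divide_le_eq)
      finally show "fact l * exp n / n ^ l \<le> exp 1 * n" .
    qed (use n in auto)
    also have "exp 1 * (exp 1 * n) = exp 2 * n" by (simp flip: exp_add mult.assoc)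
    finally show "exp (n - n * \<mu> * c * y l) * (\<Prod>i<l. ?g i) * fact l
        \<le> exp 2 * real N * exp (real N * (3 * \<mu>\<^sup>2 - \<mu> * (2 / exp 1)))"
      by (simp add: n_def)
  qed
  finally show ?thesis .
qed

lemma measurable_avg_tvd [measurable]:
  "(\<lambda>x. avg_tvd N k x y) \<in> borel_measurable (\<Pi>\<^sub>M i\<in>{..<k}. \<Pi>\<^sub>M j\<in>{..<N}. borel)"
  unfolding avg_tvd_def by measurable

lemma sets_uniform_sparse_simplex_tuples:
  "sets (uniform_sparse_simplex_tuples N N k) = sets (\<Pi>\<^sub>M i\<in>{..<k}. \<Pi>\<^sub>M j\<in>{..<N}. borel)"
  unfolding uniform_sparse_simplex_tuples_def uniform_sparse_simplex_full
  by (intro sets_PiM_cong refl sets_uniform_face)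

text \<open>Exponential Markov inequality: the indicator of the event is at most a product of
  exponentials of the k distances, and the integral of this product factors because the tuple is
  drawn from a product measure.\<close>

lemma emeasure_avg_tvd_le:
  assumes N: "1 \<le> N" and k: "1 \<le> k" and \<epsilon>: "0 \<le> \<epsilon>" "\<epsilon> \<le> 3"
    and y: "\<And>i. i < k \<Longrightarrow> y i \<in> prob_simplex N"
  defines "M \<equiv> uniform_sparse_simplex_tuples N N k"
  shows "emeasure M {x \<in> space M. avg_tvd N k x y \<le> 2 / exp 1 - \<epsilon>}
    \<le> ennreal ((exp 2 * real N * exp (- (real N * \<epsilon>\<^sup>2 / 12))) ^ k)"
proof -
  \<comment> \<open>This value minimizes the exponent 3 \<mu>^2 - \<mu> \<epsilon>, with minimum -
    \<epsilon>^2 / 12; \<epsilon> \<le> 3 ensures \<mu> \<le> 1/2.\<close>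
  define \<mu> where "\<mu> = \<epsilon> / 6"
  define d where "d = 2 / exp 1 - \<epsilon>"
  let ?E = "{x \<in> space M. avg_tvd N k x y \<le> d}"
  let ?f = "\<lambda>i x. ennreal (exp (real N * \<mu> * d)) * ennreal (exp (- (real N * \<mu>) * tvd N x (y i)))"
  have M_eq: "M = (\<Pi>\<^sub>M i\<in>{..<k}. uniform_face {..<N} N)"
    by (simp add: M_def uniform_sparse_simplex_tuples_def uniform_sparse_simplex_full)
  interpret U: prob_space "uniform_face {..<N} N"
    by (rule prob_space_uniform_face) simp
  interpret product_sigma_finite "\<lambda>_::nat. uniform_face {..<N} N" by standard
  have E [measurable]: "?E \<in> sets M"
    using sets_uniform_sparse_simplex_tuples[of N k, folded M_def, measurable_cong] by measurable
  have "indicator ?E x \<le> (\<Prod>i<k. ?f i (x i))" for x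
  proof (cases "x \<in> ?E")
    case True
    then have "(\<Sum>i<k. tvd N (x i) (y i)) \<le> real k * d"
      using k by (simp add: avg_tvd_def field_simps)
    then have "(real N * \<mu>) * (\<Sum>i<k. tvd N (x i) (y i)) \<le> (real N * \<mu>) * (real k * d)"
      using \<epsilon> by (intro mult_left_mono) (auto simp: \<mu>_def)
    then have "0 \<le> (\<Sum>i<k. real N * \<mu> * d + (- (real N * \<mu>) * tvd N (x i) (y i)))"
      by (simp only: sum.distrib sum_distrib_left[symmetric] sum_constant card_lessThan)
        (simp add: algebra_simps)
    then have "1 \<le> (\<Prod>i<k. exp (real N * \<mu> * d + (- (real N * \<mu>) * tvd N (x i) (y i))))"
      by (simp add: flip: exp_sum)
    then have "1 \<le> ennreal (\<Prod>i<k. exp (real N * \<mu> * d + (- (real N * \<mu>) * tvd N (x i) (y i))))"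
      by (simp add: ennreal_ge_1)
    also have "\<dots> = (\<Prod>i<k. ?f i (x i))"
      by (subst prod_ennreal[symmetric]) (simp_all add: exp_add ennreal_mult del: add_uminus_conv_diff)
    finally show ?thesis using True by simp
  qed simp
  then have "emeasure M ?E \<le> (\<integral>\<^sup>+x. (\<Prod>i<k. ?f i (x i)) \<partial>M)"
    by (subst nn_integral_indicator[OF E, symmetric]) (intro nn_integral_mono)
  also have "\<dots> = (\<Prod>i<k. \<integral>\<^sup>+x. ?f i x \<partial>uniform_face {..<N} N)"
    unfolding M_eq by (rule product_nn_integral_prod) measurable
  also have "\<dots> \<le> (\<Prod>i<k. ennreal (exp 2 * real N * exp (- (real N * \<epsilon>\<^sup>2 / 12))))"
  proof (rule prod_mono_ennreal)
    fix i assume "i \<in> {..<k}"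
    then have yi: "y i \<in> prob_simplex N" using y by simp
    have "(\<integral>\<^sup>+x. ?f i x \<partial>uniform_face {..<N} N) = ennreal (exp (real N * \<mu> * d)) *
        (\<integral>\<^sup>+x. ennreal (exp (- (real N * \<mu>) * tvd N x (y i))) \<partial>uniform_face {..<N} N)"
      by (rule nn_integral_cmult) measurable
    also have "\<dots> \<le> ennreal (exp (real N * \<mu> * d)) *
        ennreal (exp 2 * real N * exp (real N * (3 * \<mu>\<^sup>2 - \<mu> * (2 / exp 1))))"
      using \<epsilon> by (intro mult_left_mono nn_integral_exp_tvd_le N yi) (auto simp: \<mu>_def)
    also have "\<dots> = ennreal (exp 2 * real N *
        exp (real N * \<mu> * d + real N * (3 * \<mu>\<^sup>2 - \<mu> * (2 / exp 1))))"
      by (simp add: exp_add mult_ac flip: ennreal_mult)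
    also have "real N * \<mu> * d + real N * (3 * \<mu>\<^sup>2 - \<mu> * (2 / exp 1)) = - (real N * \<epsilon>\<^sup>2 / 12)"
      by (simp add: \<mu>_def d_def field_simps power2_eq_square)
    finally show "(\<integral>\<^sup>+x. ?f i x \<partial>uniform_face {..<N} N)
        \<le> ennreal (exp 2 * real N * exp (- (real N * \<epsilon>\<^sup>2 / 12)))" .
  qed
  also have "\<dots> = ennreal ((exp 2 * real N * exp (- (real N * \<epsilon>\<^sup>2 / 12))) ^ k)"
    by (simp add: ennreal_power)
  finally show ?thesis by (simp add: d_def)
qed

section \<open>Gates as unitary operators\<close>

lemma nat_less_exp_iff_bit: "(j::nat) < 2 ^ n \<longleftrightarrow> (\<forall>l\<ge>n. \<not> bit j l)"
proof
  assume "j < 2 ^ n"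
  then have "take_bit n j = j" by (simp add: take_bit_nat_eq_self_iff)
  then show "\<forall>l\<ge>n. \<not> bit j l" by (metis bit_take_bit_iff not_less)
next
  assume "\<forall>l\<ge>n. \<not> bit j l"
  then have "take_bit n j = j" by (auto simp: bit_eq_iff bit_take_bit_iff) (meson not_le)
  then show "j < 2 ^ n" by (simp add: take_bit_nat_eq_self_iff)
qed

lemma bit_select_qubits: "bit (select_qubits qs j) t \<longleftrightarrow> t < length qs \<and> bit j (qs ! t)"
  by (auto simp: select_qubits_def bit_horner_sum_bit_iff)

lemma select_qubits_less: "select_qubits qs j < 2 ^ length qs"
  by (simp add: nat_less_exp_iff_bit bit_select_qubits)

text \<open>The columns in which row i of a gate on \<open>qs\<close> can be nonzero. For basis
  indices these classes partition the basis into the blocks on which the gate acts.\<close>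

definition qubit_class :: "nat \<Rightarrow> nat list \<Rightarrow> nat \<Rightarrow> nat set" where
  "qubit_class n qs i = {j. j < 2 ^ n \<and> (\<forall>l<n. l \<notin> set qs \<longrightarrow> bit i l = bit j l)}"

lemma finite_qubit_class [simp]: "finite (qubit_class n qs i)"
  by (simp add: qubit_class_def)

lemma qubit_class_subset: "qubit_class n qs i \<subseteq> {..<2 ^ n}"
  by (auto simp: qubit_class_def)

lemma qubit_class_sym:
  "i < 2 ^ n \<Longrightarrow> j < 2 ^ n \<Longrightarrow> j \<in> qubit_class n qs i \<longleftrightarrow> i \<in> qubit_class n qs j"
  unfolding qubit_class_def by blast

lemma qubit_class_eq: "j \<in> qubit_class n qs i \<Longrightarrow> qubit_class n qs j = qubit_class n qs i"
  unfolding qubit_class_def by blast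

text \<open>Within a class only the digits at \<open>qs\<close> are free, and reading them off
  identifies the class with the basis of the gate. Each block of \<open>apply_gate n qs V\<close> is
  thus a copy of \<open>V\<close>.\<close>

lemma bij_betw_select_qubits:
  assumes "distinct qs" "set qs \<subseteq> {..<n}"
  shows "bij_betw (select_qubits qs) (qubit_class n qs i) {..<2 ^ length qs}"
proof (rule bij_betw_imageI)
  show "inj_on (select_qubits qs) (qubit_class n qs i)"
  proof (rule inj_onI)
    fix j j' assume j: "j \<in> qubit_class n qs i" and j': "j' \<in> qubit_class n qs i"
      and eq: "select_qubits qs j = select_qubits qs j'"
    show "j = j'"
    proof (rule bit_eqI)
      fix l
      show "bit j l = bit j' l"
      proof (cases "l \<in> set qs")
        case True
        then obtain t where "t < length qs" "qs ! t = l" by (auto simp: in_set_conv_nth)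
        then show ?thesis using arg_cong[OF eq, of "\<lambda>c. bit c t"] by (simp add: bit_select_qubits)
      next
        case False
        then show ?thesis
          using j j' by (cases "l < n") (auto simp: qubit_class_def nat_less_exp_iff_bit)
      qed
    qed
  qed
  show "select_qubits qs ` qubit_class n qs i = {..<2 ^ length qs}"
  proof (intro equalityI subsetI)
    fix c :: nat assume "c \<in> {..<2 ^ length qs}"
    then have c: "\<And>t. t \<ge> length qs \<Longrightarrow> \<not> bit c t" by (auto simp: nat_less_exp_iff_bit)
    let ?pos = "inv_into {..<length qs} ((!) qs)"
    have pos: "?pos (qs ! t) = t" if "t < length qs" for t
      using that assms(1) by (intro inv_into_f_f) (auto simp: inj_on_nth)
    \<comment> \<open>The preimage of c takes its digits at \<open>qs\<close> from c and all others
      from i.\<close>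
    define j :: nat where
      "j = horner_sum of_bool 2 (map (\<lambda>l. if l \<in> set qs then bit c (?pos l) else bit i l) [0..<n])"
    have j: "bit j l \<longleftrightarrow> l < n \<and> (if l \<in> set qs then bit c (?pos l) else bit i l)" for l
      by (auto simp: j_def bit_horner_sum_bit_iff)
    have "j \<in> qubit_class n qs i"
      by (auto simp: qubit_class_def nat_less_exp_iff_bit j)
    moreover have "select_qubits qs j = c"
    proof (rule bit_eqI)
      fix t
      show "bit (select_qubits qs j) t = bit c t"
      proof (cases "t < length qs")
        case True
        then have "qs ! t \<in> set qs" by simp
        moreover from this have "qs ! t < n" using assms(2) by blast
        ultimately show ?thesis using True by (simp add: bit_select_qubits j pos)
      next
        case False
        with c[of t] show ?thesis by (simp add: bit_select_qubits)
      qed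
    qed
    ultimately show "c \<in> select_qubits qs ` qubit_class n qs i" by blast
  qed (use select_qubits_less in auto)
qed

lemma card_qubit_class:
  assumes "distinct qs" "set qs \<subseteq> {..<n}"
  shows "card (qubit_class n qs i) = 2 ^ length qs"
  using bij_betw_same_card[OF bij_betw_select_qubits[OF assms]] by simp

section \<open>Matrix algebra of gates on chosen qubits\<close>

lemma dim_apply_gate [simp]:
  "dim_row (apply_gate n qs V) = 2 ^ n" "dim_col (apply_gate n qs V) = 2 ^ n"
  by (simp_all add: apply_gate_def)

lemma apply_gate_carrier [simp]: "apply_gate n qs V \<in> carrier_mat (2 ^ n) (2 ^ n)"
  by (simp add: apply_gate_def)

lemma index_apply_gate:
  assumes "i < 2 ^ n" "j < 2 ^ n"
  shows "apply_gate n qs V $$ (i, j) =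
    (if j \<in> qubit_class n qs i then V $$ (select_qubits qs i, select_qubits qs j) else 0)"
  using assms by (simp add: apply_gate_def qubit_class_def)

lemma index_mult_mat_sum:
  assumes "A \<in> carrier_mat p q" "B \<in> carrier_mat q r" "i < p" "j < r"
  shows "(A * B) $$ (i, j) = (\<Sum>l<q. A $$ (i, l) * B $$ (l, j))"
  using assms by (auto simp: scalar_prod_def atLeast0LessThan)

lemma index_mult_mat_vec_sum:
  assumes "A \<in> carrier_mat p q" "v \<in> carrier_vec q" "i < p"
  shows "(A *\<^sub>v v) $ i = (\<Sum>j<q. A $$ (i, j) * v $ j)"
  using assms by (auto simp: scalar_prod_def atLeast0LessThan)

lemma index_mult_unit_vec:
  fixes A :: "'a :: semiring_1 mat"
  assumes "A \<in> carrier_mat p q" "i < p" "j < q"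
  shows "(A *\<^sub>v unit_vec q j) $ i = A $$ (i, j)"
proof -
  have "(A *\<^sub>v unit_vec q j) $ i = (\<Sum>l<q. A $$ (i, l) * unit_vec q j $ l)"
    using assms by (intro index_mult_mat_vec_sum) auto
  also have "\<dots> = (\<Sum>l<q. if l = j then A $$ (i, l) else 0)"
    using assms(3) by (intro sum.cong) auto
  finally show ?thesis using assms(3) by simp
qed

lemma mat_adjoint_carrier:
  "A \<in> carrier_mat p p \<Longrightarrow> mat_adjoint A \<in> carrier_mat p p"
  by (intro carrier_matI) (simp_all add: mat_adjoint_def)

lemma index_mat_adjoint:
  fixes A :: "complex mat"
  assumes "A \<in> carrier_mat p p" "i < p" "j < p"
  shows "mat_adjoint A $$ (i, j) = cnj (A $$ (j, i))"
  using assms by (simp add: mat_adjoint_def mat_of_rows_def)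

text \<open>Only intermediate indices in the class of i contribute, and
  \<open>bij_betw_select_qubits\<close> turns their sum into an entry of V * W.\<close>

lemma apply_gate_mult:
  assumes "distinct qs" "set qs \<subseteq> {..<n}"
    and "V \<in> carrier_mat (2 ^ length qs) (2 ^ length qs)"
    and "W \<in> carrier_mat (2 ^ length qs) (2 ^ length qs)"
  shows "apply_gate n qs V * apply_gate n qs W = apply_gate n qs (V * W)"
proof (rule eq_matI)
  fix i j assume "i < dim_row (apply_gate n qs (V * W))" "j < dim_col (apply_gate n qs (V * W))"
  then have ij: "i < 2 ^ n" "j < 2 ^ n" by simp_all
  let ?s = "select_qubits qs" and ?C = "qubit_class n qs"
  have "(apply_gate n qs V * apply_gate n qs W) $$ (i, j)
      = (\<Sum>l<2 ^ n. apply_gate n qs V $$ (i, l) * apply_gate n qs W $$ (l, j))"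
    using ij by (intro index_mult_mat_sum) auto
  also have "\<dots> = (\<Sum>l\<in>?C i. V $$ (?s i, ?s l) * (if j \<in> ?C i then W $$ (?s l, ?s j) else 0))"
    using ij qubit_class_subset[of n qs i]
    by (intro sum.mono_neutral_cong_right) (auto simp: index_apply_gate qubit_class_eq)
  also have "\<dots> = (\<Sum>c<2 ^ length qs. V $$ (?s i, c) * (if j \<in> ?C i then W $$ (c, ?s j) else 0))"
    by (rule sum.reindex_bij_betw[OF bij_betw_select_qubits[OF assms(1,2)]])
  also have "\<dots> = (if j \<in> ?C i then (V * W) $$ (?s i, ?s j) else 0)"
    using index_mult_mat_sum[OF assms(3,4) select_qubits_less select_qubits_less] by simp
  also have "\<dots> = apply_gate n qs (V * W) $$ (i, j)"
    using ij by (simp add: index_apply_gate)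
  finally show "(apply_gate n qs V * apply_gate n qs W) $$ (i, j) = apply_gate n qs (V * W) $$ (i, j)" .
qed auto

lemma apply_gate_one:
  assumes "distinct qs" "set qs \<subseteq> {..<n}"
  shows "apply_gate n qs (1\<^sub>m (2 ^ length qs)) = 1\<^sub>m (2 ^ n)"
proof (rule eq_matI)
  fix i j assume ij: "i < dim_row (1\<^sub>m (2 ^ n) :: complex mat)" "j < dim_col (1\<^sub>m (2 ^ n) :: complex mat)"
  have "i \<in> qubit_class n qs i" using ij by (simp add: qubit_class_def)
  then show "apply_gate n qs (1\<^sub>m (2 ^ length qs)) $$ (i, j) = 1\<^sub>m (2 ^ n) $$ (i, j)"
    using ij select_qubits_less[of qs]
      inj_onD[OF bij_betw_imp_inj_on[OF bij_betw_select_qubits[OF assms, of i]], of i j]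
    by (auto simp: index_apply_gate)
qed auto

lemma mat_adjoint_apply_gate:
  assumes "V \<in> carrier_mat (2 ^ length qs) (2 ^ length qs)"
  shows "mat_adjoint (apply_gate n qs V) = apply_gate n qs (mat_adjoint V)"
proof (rule eq_matI)
  fix i j assume "i < dim_row (apply_gate n qs (mat_adjoint V))"
    "j < dim_col (apply_gate n qs (mat_adjoint V))"
  then show "mat_adjoint (apply_gate n qs V) $$ (i, j) = apply_gate n qs (mat_adjoint V) $$ (i, j)"
    using qubit_class_sym[of i n j qs]
    by (simp add: index_mat_adjoint[OF apply_gate_carrier] index_apply_gate
        index_mat_adjoint[OF assms select_qubits_less select_qubits_less])
qed (use mat_adjoint_carrier[OF apply_gate_carrier[of n qs V]] in auto)

lemma apply_gate_unitary:
  assumes "distinct qs" "set qs \<subseteq> {..<n}" "V \<in> unitaries (length qs)"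
  shows "apply_gate n qs V \<in> unitaries n"
proof -
  from assms(3) have V: "V \<in> carrier_mat (2 ^ length qs) (2 ^ length qs)"
    and "mat_adjoint V * V = 1\<^sub>m (2 ^ length qs)" "V * mat_adjoint V = 1\<^sub>m (2 ^ length qs)"
    by (auto simp: unitaries_def)
  then show ?thesis
    using assms(1,2) mat_adjoint_carrier[OF V]
    by (simp add: unitaries_def mat_adjoint_apply_gate apply_gate_mult apply_gate_one)
qed

section \<open>Euclidean norm, isometry and stability of circuits\<close>

definition state_norm :: "complex vec \<Rightarrow> real" where
  "state_norm v = L2_set (\<lambda>i. cmod (v $ i)) {..<dim_vec v}"

lemma state_norm_nonneg [simp]: "0 \<le> state_norm v"
  by (simp add: state_norm_def)

lemma state_norm_power2: "(state_norm v)\<^sup>2 = (\<Sum>i<dim_vec v. (cmod (v $ i))\<^sup>2)"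
  by (simp add: state_norm_def L2_set_def sum_nonneg)

lemma state_norm_add_le:
  assumes "dim_vec u = dim_vec v"
  shows "state_norm (u + v) \<le> state_norm u + state_norm v"
proof -
  have "state_norm (u + v) \<le> L2_set (\<lambda>i. cmod (u $ i) + cmod (v $ i)) {..<dim_vec v}"
    unfolding state_norm_def using assms
    by (auto intro!: L2_set_mono norm_triangle_ineq)
  also have "\<dots> \<le> state_norm u + state_norm v"
    using L2_set_triangle_ineq[of "\<lambda>i. cmod (u $ i)" "\<lambda>i. cmod (v $ i)" "{..<dim_vec v}"] assms
    by (simp add: state_norm_def)
  finally show ?thesis .
qed

lemma state_norm_unit_vec: "i < p \<Longrightarrow> state_norm (unit_vec p i) = 1"
  by (simp add: state_norm_def L2_set_def unit_vec_def if_distrib[of cmod]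
      if_distrib[of "\<lambda>x. x\<^sup>2"] cong: if_cong)

text \<open>The squared norm of U v expands into a triple sum in which orthonormality of the columns
  of U removes the off-diagonal terms.\<close>

lemma state_norm_unitary:
  assumes U: "U \<in> unitaries n" and v: "v \<in> carrier_vec (2 ^ n)"
  shows "state_norm (U *\<^sub>v v) = state_norm v"
proof -
  let ?p = "2 ^ n :: nat"
  from U have Uc: "U \<in> carrier_mat ?p ?p" and UU: "mat_adjoint U * U = 1\<^sub>m ?p"
    by (auto simp: unitaries_def)
  have orth: "(\<Sum>i<?p. cnj (U $$ (i, j)) * U $$ (i, l)) = (if j = l then 1 else 0)"
    if "j < ?p" "l < ?p" for j l
  proof -
    have "(mat_adjoint U * U) $$ (j, l) = (\<Sum>i<?p. mat_adjoint U $$ (j, i) * U $$ (i, l))"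
      using that by (rule index_mult_mat_sum[OF mat_adjoint_carrier[OF Uc] Uc])
    also have "\<dots> = (\<Sum>i<?p. cnj (U $$ (i, j)) * U $$ (i, l))"
      using that by (intro sum.cong) (auto simp: index_mat_adjoint[OF Uc])
    finally show ?thesis using that UU by simp
  qed
  have sq: "complex_of_real ((state_norm w)\<^sup>2) = (\<Sum>i<dim_vec w. cnj (w $ i) * w $ i)" for w
    by (simp add: state_norm_power2 complex_norm_square mult.commute del: of_real_power)
  have "complex_of_real ((state_norm (U *\<^sub>v v))\<^sup>2)
      = (\<Sum>i<?p. cnj (\<Sum>j<?p. U $$ (i, j) * v $ j) * (\<Sum>l<?p. U $$ (i, l) * v $ l))"
    using Uc v unfolding sq by (intro sum.cong) (auto simp: index_mult_mat_vec_sum simp del: index_mult_mat_vec)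
  also have "\<dots> = (\<Sum>i<?p. \<Sum>j<?p. \<Sum>l<?p. cnj (v $ j) * v $ l * (cnj (U $$ (i, j)) * U $$ (i, l)))"
    unfolding cnj_sum sum_product by (intro sum.cong refl) (simp add: mult_ac)
  also have "\<dots> = (\<Sum>j<?p. \<Sum>i<?p. \<Sum>l<?p. cnj (v $ j) * v $ l * (cnj (U $$ (i, j)) * U $$ (i, l)))"
    by (rule sum.swap)
  also have "\<dots> = (\<Sum>j<?p. \<Sum>l<?p. \<Sum>i<?p. cnj (v $ j) * v $ l * (cnj (U $$ (i, j)) * U $$ (i, l)))"
    by (intro sum.cong sum.swap refl)
  also have "\<dots> = (\<Sum>j<?p. \<Sum>l<?p. cnj (v $ j) * v $ l * (if j = l then 1 else 0))"
    by (simp add: orth flip: sum_distrib_left)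
  also have "\<dots> = complex_of_real ((state_norm v)\<^sup>2)"
    using v unfolding sq by (simp add: if_distrib cong: if_cong)
  finally have "(state_norm (U *\<^sub>v v))\<^sup>2 = (state_norm v)\<^sup>2" by (simp only: of_real_eq_iff)
  then show ?thesis by simp
qed

text \<open>An entry is a coordinate of the image of a basis vector, which has norm 1. This keeps
  the number of grid cells for gate entries finite.\<close>

lemma unitary_entry_le:
  assumes "U \<in> unitaries n" "i < 2 ^ n" "j < 2 ^ n"
  shows "cmod (U $$ (i, j)) \<le> 1"
proof -
  have U: "U \<in> carrier_mat (2 ^ n) (2 ^ n)" using assms by (simp add: unitaries_def)
  have "cmod ((U *\<^sub>v unit_vec (2 ^ n) j) $ i) \<le> state_norm (U *\<^sub>v unit_vec (2 ^ n) j)"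
    unfolding state_norm_def using U assms by (intro member_le_L2_set) auto
  also have "\<dots> = 1"
    using assms by (simp add: state_norm_unitary state_norm_unit_vec)
  finally show ?thesis using index_mult_unit_vec[OF U assms(2,3)] by simp
qed

text \<open>Write q = 2^g for g = \<open>length qs\<close>. Each row of the difference has at most q
  nonzero entries, so Cauchy-Schwarz costs a factor q in the squared norm; each index lies in q
  classes, which costs a second one. The bound does not depend on n.\<close>

lemma state_norm_apply_gate_diff_le:
  assumes qs: "distinct qs" "set qs \<subseteq> {..<n}"
    and close: "\<And>a b. a < 2 ^ length qs \<Longrightarrow> b < 2 ^ length qs \<Longrightarrow>
      cmod (V $$ (a, b) - W $$ (a, b)) \<le> \<delta>"
    and v: "v \<in> carrier_vec (2 ^ n)"
  shows "state_norm (apply_gate n qs V *\<^sub>v v - apply_gate n qs W *\<^sub>v v)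
    \<le> 2 ^ length qs * \<delta> * state_norm v"
proof -
  let ?p = "2 ^ n :: nat" and ?q = "2 ^ length qs :: real"
  let ?C = "qubit_class n qs" and ?d = "apply_gate n qs V *\<^sub>v v - apply_gate n qs W *\<^sub>v v"
  \<comment> \<open>Read off from the entry (0, 0); the comparison of squares at the end needs
    it.\<close>
  have "0 \<le> \<delta>" using order_trans[OF norm_ge_zero close[of 0 0]] by simp
  have entry: "(cmod (?d $ i))\<^sup>2 \<le> \<delta>\<^sup>2 * ?q * (\<Sum>j\<in>?C i. (cmod (v $ j))\<^sup>2)" if "i < ?p" for i
  proof -
    have "?d $ i = (\<Sum>j<?p. (apply_gate n qs V $$ (i, j) - apply_gate n qs W $$ (i, j)) * v $ j)"
      using that v by (simp add: index_mult_mat_vec_sum[OF apply_gate_carrier] sum_subtractf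
          left_diff_distrib del: index_mult_mat_vec)
    also have "\<dots> = (\<Sum>j\<in>?C i. (V $$ (select_qubits qs i, select_qubits qs j)
        - W $$ (select_qubits qs i, select_qubits qs j)) * v $ j)"
      using that qubit_class_subset[of n qs i]
      by (intro sum.mono_neutral_cong_right) (auto simp: index_apply_gate)
    also have "cmod \<dots> \<le> (\<Sum>j\<in>?C i. \<delta> * cmod (v $ j))"
      using close[OF select_qubits_less select_qubits_less]
      by (intro sum_norm_le) (auto simp: norm_mult intro!: mult_right_mono)
    finally have "(cmod (?d $ i))\<^sup>2 \<le> (\<delta> * (\<Sum>j\<in>?C i. cmod (v $ j)))\<^sup>2"
      by (intro power_mono) (auto simp: sum_distrib_left)
    also have "\<dots> \<le> \<delta>\<^sup>2 * ((\<Sum>j\<in>?C i. (cmod (v $ j))\<^sup>2) * card (?C i))"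
      unfolding power_mult_distrib by (intro mult_left_mono sum_squared_le_sum_of_squares) auto
    finally show ?thesis by (simp add: card_qubit_class[OF qs] mult_ac)
  qed
  have "(state_norm ?d)\<^sup>2 \<le> (\<Sum>i<?p. \<delta>\<^sup>2 * ?q * (\<Sum>j\<in>?C i. (cmod (v $ j))\<^sup>2))"
    unfolding state_norm_power2 by (intro order_trans[OF sum_mono[OF entry]]) auto
  also have "\<dots> = \<delta>\<^sup>2 * ?q * (\<Sum>i<?p. \<Sum>j\<in>?C i. (cmod (v $ j))\<^sup>2)"
    by (simp add: sum_distrib_left)
  \<comment> \<open>Double counting: by symmetry of the class relation, j occurs once for each
    member of its own class.\<close>
  also have "(\<Sum>i<?p. \<Sum>j\<in>?C i. (cmod (v $ j))\<^sup>2) = (\<Sum>i<?p. \<Sum>j | j \<in> {..<?p} \<and> j \<in> ?C i. (cmod (v $ j))\<^sup>2)"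
    using qubit_class_subset by (intro sum.cong) auto
  also have "\<dots> = (\<Sum>j<?p. \<Sum>i | i \<in> {..<?p} \<and> j \<in> ?C i. (cmod (v $ j))\<^sup>2)"
    by (rule sum.swap_restrict) auto
  also have "\<dots> = (\<Sum>j<?p. real (card (?C j)) * (cmod (v $ j))\<^sup>2)"
  proof (intro sum.cong refl)
    fix j assume "j \<in> {..<?p}"
    then have "{i. i \<in> {..<?p} \<and> j \<in> ?C i} = ?C j"
      using qubit_class_sym[of _ n j qs] qubit_class_subset[of n qs j] by blast
    then show "(\<Sum>i | i \<in> {..<?p} \<and> j \<in> ?C i. (cmod (v $ j))\<^sup>2) = real (card (?C j)) * (cmod (v $ j))\<^sup>2"
      by simp
  qed
  also have "\<dots> = ?q * (state_norm v)\<^sup>2"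
    using v by (simp add: state_norm_power2 card_qubit_class[OF qs] sum_distrib_left)
  also have "\<delta>\<^sup>2 * ?q * (?q * (state_norm v)\<^sup>2) = (?q * \<delta> * state_norm v)\<^sup>2"
    by (simp add: power2_eq_square)
  finally show ?thesis by (rule power2_le_imp_le) (simp add: \<open>0 \<le> \<delta>\<close>)
qed

text \<open>Gates are kept as pairs rather than as matrices on n qubits, since relabelling acts on
  the qubit list alone and discretization on the small unitary alone.\<close>

definition gate_data :: "nat \<Rightarrow> nat \<Rightarrow> (nat list \<times> complex mat) set" where
  "gate_data g n = {(qs, V). distinct qs \<and> length qs = g \<and> set qs \<subseteq> {..<n} \<and> V \<in> unitaries g}"

definition circuit_mat :: "nat \<Rightarrow> (nat list \<times> complex mat) list \<Rightarrow> complex mat" where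
  "circuit_mat n gs = foldr (*) (map (\<lambda>(qs, V). apply_gate n qs V) gs) (1\<^sub>m (2 ^ n))"

lemma circuit_mat_simps [simp]:
  "circuit_mat n [] = 1\<^sub>m (2 ^ n)"
  "circuit_mat n ((qs, V) # gs) = apply_gate n qs V * circuit_mat n gs"
  by (simp_all add: circuit_mat_def)

lemma circuit_mat_carrier [simp]: "circuit_mat n gs \<in> carrier_mat (2 ^ n) (2 ^ n)"
  by (induction gs) auto

lemma circuits_eq: "circuits g b n = circuit_mat n ` {gs. length gs \<le> b \<and> set gs \<subseteq> gate_data g n}"
proof -
  let ?f = "\<lambda>(qs, V). apply_gate n qs V"
  have "gates g n = ?f ` gate_data g n"
    unfolding gates_def gate_data_def by force
  then have "set Us \<subseteq> gates g n \<longleftrightarrow> (\<exists>gs. set gs \<subseteq> gate_data g n \<and> Us = map ?f gs)" for Us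
    using lists_image[of ?f "gate_data g n"] unfolding lists_eq_set by blast
  then show ?thesis
    unfolding circuits_def circuit_mat_def by force
qed

lemma state_norm_circuit:
  assumes "set gs \<subseteq> gate_data g n" "v \<in> carrier_vec (2 ^ n)"
  shows "state_norm (circuit_mat n gs *\<^sub>v v) = state_norm v"
  using assms(1)
proof (induction gs)
  case (Cons x gs)
  obtain qs V where x: "x = (qs, V)" by (cases x)
  have "apply_gate n qs V \<in> unitaries n"
    using Cons.prems by (auto simp: x gate_data_def intro!: apply_gate_unitary)
  then have "state_norm (apply_gate n qs V *\<^sub>v (circuit_mat n gs *\<^sub>v v))
      = state_norm (circuit_mat n gs *\<^sub>v v)"
    using assms(2) by (rule state_norm_unitary[OF _ mult_mat_vec_carrier[OF circuit_mat_carrier]])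
  then show ?case
    using Cons assms(2) by (simp add: x assoc_mult_mat_vec[of _ "2 ^ n" "2 ^ n" _ "2 ^ n"])
qed (use assms(2) in simp)

definition close_gates :: "nat \<Rightarrow> real \<Rightarrow> (nat list \<times> complex mat) \<Rightarrow> (nat list \<times> complex mat) \<Rightarrow> bool" where
  "close_gates g \<delta> x y \<longleftrightarrow> fst x = fst y \<and>
    (\<forall>a<2 ^ g. \<forall>b<2 ^ g. cmod (snd x $$ (a, b) - snd y $$ (a, b)) \<le> \<delta>)"

text \<open>Hybrid argument: A u - B w = A (u - w) + (A - B) w. As A is an isometry and w has the
  norm of v, the errors of the single gates add up instead of multiplying.\<close>

lemma state_norm_circuit_diff_le:
  assumes "list_all2 (close_gates g \<delta>) gs hs" "set gs \<subseteq> gate_data g n" "set hs \<subseteq> gate_data g n"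
    and v: "v \<in> carrier_vec (2 ^ n)"
  shows "state_norm (circuit_mat n gs *\<^sub>v v - circuit_mat n hs *\<^sub>v v)
    \<le> real (length gs) * (2 ^ g * \<delta>) * state_norm v"
  using assms(1-3)
proof (induction rule: list_all2_induct)
  case Nil
  have "1\<^sub>m (2 ^ n) *\<^sub>v v - 1\<^sub>m (2 ^ n) *\<^sub>v v = 0\<^sub>v (2 ^ n)" using v by simp
  then show ?case by (simp add: state_norm_def L2_set_0' del: one_mult_mat_vec)
next
  case (Cons x gs y hs)
  obtain qs V where x: "x = (qs, V)" by (cases x)
  obtain W where y: "y = (qs, W)" using Cons.hyps(1) by (cases y) (auto simp: x close_gates_def)
  have qs: "distinct qs" "set qs \<subseteq> {..<n}" "length qs = g" and V: "V \<in> unitaries g"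
    using Cons.prems(1) by (auto simp: x gate_data_def)
  let ?A = "apply_gate n qs V" and ?B = "apply_gate n qs W"
  define u where "u = circuit_mat n gs *\<^sub>v v"
  define w where "w = circuit_mat n hs *\<^sub>v v"
  have u: "u \<in> carrier_vec (2 ^ n)" and w: "w \<in> carrier_vec (2 ^ n)"
    using v by (auto simp: u_def w_def intro!: mult_mat_vec_carrier)
  have assoc: "circuit_mat n (x # gs) *\<^sub>v v = ?A *\<^sub>v u" "circuit_mat n (y # hs) *\<^sub>v v = ?B *\<^sub>v w"
    using v by (simp_all add: x y u_def w_def assoc_mult_mat_vec[of _ "2 ^ n" "2 ^ n" _ "2 ^ n"])
  have "?A *\<^sub>v u - ?B *\<^sub>v w = ?A *\<^sub>v (u - w) + (?A *\<^sub>v w - ?B *\<^sub>v w)"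
    using u w by (intro eq_vecI)
      (simp_all add: mult_minus_distrib_mat_vec[of _ "2 ^ n" "2 ^ n"] del: index_mult_mat_vec)
  then have "state_norm (?A *\<^sub>v u - ?B *\<^sub>v w)
      \<le> state_norm (?A *\<^sub>v (u - w)) + state_norm (?A *\<^sub>v w - ?B *\<^sub>v w)"
    using state_norm_add_le[of "?A *\<^sub>v (u - w)" "?A *\<^sub>v w - ?B *\<^sub>v w"] by simp
  also have "state_norm (?A *\<^sub>v (u - w)) = state_norm (u - w)"
    using qs V u w by (intro state_norm_unitary[of _ n] apply_gate_unitary) auto
  also have "state_norm (u - w) \<le> real (length gs) * (2 ^ g * \<delta>) * state_norm v"
    using Cons by (simp add: u_def w_def)
  also have "state_norm (?A *\<^sub>v w - ?B *\<^sub>v w) \<le> 2 ^ g * \<delta> * state_norm w"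
    using state_norm_apply_gate_diff_le[OF qs(1,2) _ w, of V W \<delta>] Cons.hyps(1)
    by (simp add: qs(3) x y close_gates_def)
  also have "state_norm w = state_norm v"
    unfolding w_def using Cons.prems(2) v by (intro state_norm_circuit) auto
  finally show ?case unfolding assoc by (simp add: algebra_simps)
qed

section \<open>Outcome distributions as sums over residue classes\<close>

lemma outcome_prob_eq:
  assumes "m \<le> n" "c < 2 ^ m"
  shows "outcome_prob m n x c = (\<Sum>i | i \<in> {..<2 ^ n} \<and> i mod 2 ^ m = c. (cmod (x $ i))\<^sup>2)"
proof -
  have pow: "(2::nat) ^ n = 2 ^ m * 2 ^ (n - m)" using assms(1) by (simp flip: power_add)
  have "bij_betw (\<lambda>c'. c + 2 ^ m * c') {..<2 ^ (n - m)} {i. i \<in> {..<2 ^ n} \<and> i mod 2 ^ m = c}"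
  proof (rule bij_betw_byWitness[where f' = "\<lambda>i. i div 2 ^ m"])
    show "(\<lambda>c'. c + 2 ^ m * c') ` {..<2 ^ (n - m)} \<subseteq> {i. i \<in> {..<2 ^ n} \<and> i mod 2 ^ m = c}"
    proof (rule image_subsetI)
      fix c' assume "c' \<in> {..<(2::nat) ^ (n - m)}"
      then have "2 ^ m * Suc c' \<le> (2::nat) ^ n" unfolding pow by (intro mult_left_mono) auto
      then show "c + 2 ^ m * c' \<in> {i. i \<in> {..<2 ^ n} \<and> i mod 2 ^ m = c}" using assms(2) by simp
    qed
    show "(\<lambda>i. i div 2 ^ m) ` {i. i \<in> {..<2 ^ n} \<and> i mod 2 ^ m = c} \<subseteq> {..<2 ^ (n - m)}"
      unfolding pow by (auto simp: less_mult_imp_div_less mult.commute)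
  qed (use assms(2) in auto)
  from sum.reindex_bij_betw[OF this, of "\<lambda>i. (cmod (x $ i))\<^sup>2"] show ?thesis
    using assms(2) by (simp add: outcome_prob_def)
qed

lemma sum_outcome_classes:
  fixes f :: "nat \<Rightarrow> real"
  shows "(\<Sum>c<2 ^ m. \<Sum>i | i \<in> {..<2 ^ n} \<and> i mod 2 ^ m = c. f i) = (\<Sum>i<2 ^ n. f i)"
  by (rule sum.group) auto

lemma outcome_prob_simplex:
  assumes "m \<le> n" "x \<in> carrier_vec (2 ^ n)" "state_norm x = 1"
  shows "outcome_prob m n x \<in> prob_simplex (2 ^ m)"
proof -
  have "(\<Sum>c<2 ^ m. outcome_prob m n x c) = (state_norm x)\<^sup>2"
    using assms(1,2) by (simp add: outcome_prob_eq sum_outcome_classes[unfolded lessThan_iff] state_norm_power2)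
  then show ?thesis
    using assms(3) by (auto simp: prob_simplex_def outcome_prob_def intro!: sum_nonneg)
qed

text \<open>Grouping indices by outcome does not increase the distance. Then |a^2 - b^2| = |a - b|
  (a + b) for the moduli, followed by the inequalities of Cauchy-Schwarz and Minkowski.\<close>

lemma tvd_outcome_prob_le:
  assumes "m \<le> n" "u \<in> carrier_vec (2 ^ n)" "v \<in> carrier_vec (2 ^ n)"
  shows "tvd (2 ^ m) (outcome_prob m n u) (outcome_prob m n v)
    \<le> state_norm (u - v) * (state_norm u + state_norm v)"
proof -
  have "tvd (2 ^ m) (outcome_prob m n u) (outcome_prob m n v)
      \<le> (\<Sum>c<2 ^ m. \<Sum>i | i \<in> {..<2 ^ n} \<and> i mod 2 ^ m = c. \<bar>(cmod (u $ i))\<^sup>2 - (cmod (v $ i))\<^sup>2\<bar>)"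
    unfolding tvd_def using assms(1)
    by (intro sum_mono) (simp add: outcome_prob_eq flip: sum_subtractf)
  also have "\<dots> = (\<Sum>i<2 ^ n. \<bar>(cmod (u $ i))\<^sup>2 - (cmod (v $ i))\<^sup>2\<bar>)"
    by (rule sum_outcome_classes)
  also have "\<dots> \<le> (\<Sum>i<2 ^ n. \<bar>cmod ((u - v) $ i)\<bar> * \<bar>cmod (u $ i) + cmod (v $ i)\<bar>)"
  proof (rule sum_mono)
    fix i :: nat assume "i \<in> {..<2 ^ n}"
    then have "(u - v) $ i = u $ i - v $ i" using assms by simp
    moreover have "(cmod (u $ i))\<^sup>2 - (cmod (v $ i))\<^sup>2
        = (cmod (u $ i) - cmod (v $ i)) * (cmod (u $ i) + cmod (v $ i))"
      by (simp add: power2_eq_square algebra_simps)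
    ultimately show "\<bar>(cmod (u $ i))\<^sup>2 - (cmod (v $ i))\<^sup>2\<bar>
        \<le> \<bar>cmod ((u - v) $ i)\<bar> * \<bar>cmod (u $ i) + cmod (v $ i)\<bar>"
      by (simp add: abs_mult mult_right_mono norm_triangle_ineq3)
  qed
  also have "\<dots> \<le> state_norm (u - v) * L2_set (\<lambda>i. cmod (u $ i) + cmod (v $ i)) {..<2 ^ n}"
    using assms by (intro order_trans[OF L2_set_mult_ineq]) (simp add: state_norm_def)
  also have "\<dots> \<le> state_norm (u - v) * (state_norm u + state_norm v)"
    using assms by (intro mult_left_mono order_trans[OF L2_set_triangle_ineq]) (simp_all add: state_norm_def)
  finally show ?thesis .
qed

text \<open>The factor 2 is the sum of the norms of the two output states, both equal to 1.\<close>

lemma avg_tvd_outcome_tuple_le: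
  assumes close: "list_all2 (close_gates g \<delta>) gs hs"
    and gs: "set gs \<subseteq> gate_data g n" and hs: "set hs \<subseteq> gate_data g n"
    and "m \<le> n" "1 \<le> k" "k \<le> 2 ^ n"
  shows "avg_tvd (2 ^ m) k (outcome_tuple m n k (circuit_mat n gs)) (outcome_tuple m n k (circuit_mat n hs))
    \<le> 2 * real (length gs) * 2 ^ g * \<delta>"
proof -
  have "tvd (2 ^ m) (outcome_tuple m n k (circuit_mat n gs) i) (outcome_tuple m n k (circuit_mat n hs) i)
      \<le> 2 * real (length gs) * 2 ^ g * \<delta>" if "i < k" for i
  proof -
    define e :: "complex vec" where "e = unit_vec (2 ^ n) i"
    have e: "e \<in> carrier_vec (2 ^ n)" "state_norm e = 1"
      using that assms(6) by (simp_all add: e_def state_norm_unit_vec)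
    have "tvd (2 ^ m) (outcome_prob m n (circuit_mat n gs *\<^sub>v e)) (outcome_prob m n (circuit_mat n hs *\<^sub>v e))
        \<le> state_norm (circuit_mat n gs *\<^sub>v e - circuit_mat n hs *\<^sub>v e) *
          (state_norm (circuit_mat n gs *\<^sub>v e) + state_norm (circuit_mat n hs *\<^sub>v e))"
      using e(1) assms(4) by (intro tvd_outcome_prob_le mult_mat_vec_carrier[OF circuit_mat_carrier])
    also have "\<dots> = state_norm (circuit_mat n gs *\<^sub>v e - circuit_mat n hs *\<^sub>v e) * 2"
      using e by (simp add: state_norm_circuit[OF gs] state_norm_circuit[OF hs])
    also have "\<dots> \<le> real (length gs) * (2 ^ g * \<delta>) * 1 * 2"
      using state_norm_circuit_diff_le[OF close gs hs e(1)] e(2) by (intro mult_right_mono) auto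
    finally show ?thesis using that by (simp add: outcome_tuple_def e_def mult_ac)
  qed
  then have "avg_tvd (2 ^ m) k (outcome_tuple m n k (circuit_mat n gs)) (outcome_tuple m n k (circuit_mat n hs))
      \<le> (\<Sum>i<k. 2 * real (length gs) * 2 ^ g * \<delta>) / real k"
    unfolding avg_tvd_def by (intro divide_right_mono sum_mono) auto
  then show ?thesis using assms(5) by simp
qed

section \<open>Relabelling of qubits\<close>

text \<open>Glues the identity on the first M positions, a bijection of the rest of T onto an
  interval starting at M, and any bijection between the complements. It serves to move the qubits
  touched by a circuit next to those that must stay in place.\<close>

lemma ex_bij_into_initial_segment:
  fixes T :: "nat set"
  assumes T: "T \<subseteq> {..<n}" "card T \<le> c"
  shows "\<exists>\<pi>. bij_betw \<pi> {..<n} {..<n} \<and> (\<forall>l<M. \<pi> l = l) \<and> \<pi> ` T \<subseteq> {..<M + c}"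
proof (cases "n \<le> M + c")
  case True
  then show ?thesis using T by (intro exI[of _ id]) auto
next
  case False
  define T' where "T' = T - {..<M}"
  define A where "A = {M..<M + card T'}"
  have fin: "finite T" using T(1) finite_subset by blast
  have "card T' \<le> card T" unfolding T'_def by (rule card_mono[OF fin]) auto
  then have T': "card T' \<le> c" "T' \<subseteq> {M..<n}" using T by (auto simp: T'_def)
  have A: "A \<subseteq> {M..<n}" "card A = card T'" using T' False by (auto simp: A_def)
  obtain f where f: "bij_betw f T' A"
    using A(2) fin by (metis A_def T'_def finite_Diff finite_atLeastLessThan finite_same_card_bij)
  have "card ({M..<n} - T') = card ({M..<n} - A)"
    using T'(2) A by (simp add: card_Diff_subset finite_subset)
  then obtain h where h: "bij_betw h ({M..<n} - T') ({M..<n} - A)"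
    by (metis finite_Diff finite_atLeastLessThan finite_same_card_bij)
  define \<pi> where "\<pi> = (\<lambda>l. if l \<in> {..<M} then id l else if l \<in> T' then f l else h l)"
  have "bij_betw (\<lambda>l. if l \<in> T' then f l else h l) (T' \<union> ({M..<n} - T')) (A \<union> ({M..<n} - A))"
    by (rule bij_betw_disjoint_Un[OF f h]) auto
  then have "bij_betw \<pi> ({..<M} \<union> (T' \<union> ({M..<n} - T'))) ({..<M} \<union> (A \<union> ({M..<n} - A)))"
    unfolding \<pi>_def
    by (rule bij_betw_disjoint_Un[OF bij_betw_id]) (use T'(2) A(1) in auto)
  moreover have "{..<M} \<union> (T' \<union> ({M..<n} - T')) = {..<n}" "{..<M} \<union> (A \<union> ({M..<n} - A)) = {..<n}"
    using T'(2) A(1) False by auto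
  moreover have "\<pi> ` T \<subseteq> {..<M + c}"
  proof (rule image_subsetI)
    fix l assume "l \<in> T"
    show "\<pi> l \<in> {..<M + c}"
    proof (cases "l < M")
      case False
      then have "l \<in> T'" using \<open>l \<in> T\<close> by (simp add: T'_def)
      then have "f l \<in> A" using f by (auto simp: bij_betw_def)
      then show ?thesis using \<open>l \<in> T'\<close> False T'(1) by (auto simp: \<pi>_def A_def)
    qed (simp add: \<pi>_def)
  qed
  ultimately show ?thesis by (intro exI[of _ \<pi>]) (auto simp: \<pi>_def)
qed

locale qubit_permutation =
  fixes n :: nat and \<pi> :: "nat \<Rightarrow> nat"
  assumes bij: "bij_betw \<pi> {..<n} {..<n}"
begin

text \<open>The permutation of the basis that moves qubit l to position \<pi> l; the digit at a
  position is therefore fetched through the inverse of \<pi>.\<close>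

definition index_map :: "nat \<Rightarrow> nat" where
  "index_map i = horner_sum of_bool 2 (map (\<lambda>l. bit i (the_inv_into {..<n} \<pi> l)) [0..<n])"

lemma perm_less: "l < n \<Longrightarrow> \<pi> l < n"
  using bij by (auto simp: bij_betw_def)

lemma perm_inj: "inj_on \<pi> {..<n}"
  using bij by (simp add: bij_betw_def)

lemma bit_index_map: "l < n \<Longrightarrow> bit (index_map i) (\<pi> l) \<longleftrightarrow> bit i l"
  using the_inv_into_f_f[OF perm_inj, of l] perm_less[of l]
  by (simp add: index_map_def bit_horner_sum_bit_iff)

lemma index_map_less: "index_map i < 2 ^ n"
  by (simp add: nat_less_exp_iff_bit index_map_def bit_horner_sum_bit_iff)

lemma perm_surj:
  assumes "l < n"
  obtains l' where "l' < n" "\<pi> l' = l"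
proof -
  have "l \<in> \<pi> ` {..<n}" using bij assms by (simp add: bij_betw_def)
  then show ?thesis using that by auto
qed

lemma index_map_eqI:
  assumes "j < 2 ^ n" "\<And>l. l < n \<Longrightarrow> bit j (\<pi> l) \<longleftrightarrow> bit i l"
  shows "index_map i = j"
proof (rule bit_eqI)
  fix l
  show "bit (index_map i) l = bit j l"
  proof (cases "l < n")
    case True
    then show ?thesis using assms(2) bit_index_map by (metis perm_surj)
  next
    case False
    then show ?thesis
      using assms(1) index_map_less[of i] by (simp add: nat_less_exp_iff_bit)
  qed
qed

lemma bij_betw_index_map: "bij_betw index_map {..<2 ^ n} {..<2 ^ n}"
proof -
  have "inj_on index_map {..<2 ^ n}"
  proof (rule inj_onI)
    fix i j assume i: "i \<in> {..<2 ^ n}" and j: "j \<in> {..<2 ^ n}" and eq: "index_map i = index_map j"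
    show "i = j"
    proof (rule bit_eqI)
      fix l
      show "bit i l = bit j l"
      proof (cases "l < n")
        case True
        then show ?thesis using bit_index_map[of l i] bit_index_map[of l j] eq by simp
      next
        case False
        then show ?thesis using i j by (simp add: nat_less_exp_iff_bit)
      qed
    qed
  qed
  moreover have "index_map ` {..<2 ^ n} \<subseteq> {..<2 ^ n}" using index_map_less by auto
  ultimately show ?thesis by (simp add: bij_betw_def endo_inj_surj)
qed

lemma select_qubits_index_map:
  assumes "set qs \<subseteq> {..<n}"
  shows "select_qubits (map \<pi> qs) (index_map i) = select_qubits qs i"
proof (rule bit_eqI)
  fix t
  show "bit (select_qubits (map \<pi> qs) (index_map i)) t = bit (select_qubits qs i) t"
  proof (cases "t < length qs")
    case True
    then have "qs ! t < n" using assms nth_mem by blast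
    with True show ?thesis by (simp add: bit_select_qubits bit_index_map)
  qed (simp add: bit_select_qubits)
qed

lemma index_map_mem_qubit_class_iff:
  assumes "set qs \<subseteq> {..<n}" "j < 2 ^ n"
  shows "index_map j \<in> qubit_class n (map \<pi> qs) (index_map i) \<longleftrightarrow> j \<in> qubit_class n qs i"
proof -
  have mem: "\<pi> l \<in> set (map \<pi> qs) \<longleftrightarrow> l \<in> set qs" if "l < n" for l
    using inj_on_image_mem_iff[OF perm_inj, of l "set qs"] that assms(1) by simp
  have "(\<forall>l<n. l \<notin> set (map \<pi> qs) \<longrightarrow> bit (index_map i) l = bit (index_map j) l) \<longleftrightarrow>
      (\<forall>l<n. \<pi> l \<notin> set (map \<pi> qs) \<longrightarrow> bit (index_map i) (\<pi> l) = bit (index_map j) (\<pi> l))"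
    by (metis perm_less perm_surj)
  also have "\<dots> \<longleftrightarrow> (\<forall>l<n. l \<notin> set qs \<longrightarrow> bit i l = bit j l)"
    by (simp only: mem bit_index_map cong: all_cong)
  finally show ?thesis using assms(2) index_map_less[of j] by (simp only: qubit_class_def mem_Collect_eq) 
qed

lemma index_apply_gate_map:
  assumes "set qs \<subseteq> {..<n}" "i < 2 ^ n" "j < 2 ^ n"
  shows "apply_gate n (map \<pi> qs) V $$ (index_map i, index_map j) = apply_gate n qs V $$ (i, j)"
  using assms by (simp add: index_apply_gate index_map_less index_map_mem_qubit_class_iff
      select_qubits_index_map)

definition relabel :: "nat list \<times> complex mat \<Rightarrow> nat list \<times> complex mat" where
  "relabel x = (map \<pi> (fst x), snd x)"

lemma relabel_mem_gate_data:
  assumes "x \<in> gate_data g n"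
  shows "relabel x \<in> gate_data g n"
proof -
  have "distinct (fst x)" "set (fst x) \<subseteq> {..<n}" using assms by (auto simp: gate_data_def)
  moreover from this(2) have "\<pi> ` set (fst x) \<subseteq> {..<n}" using perm_less by auto
  ultimately show ?thesis
    using assms inj_on_subset[OF perm_inj, of "set (fst x)"]
    by (auto simp: gate_data_def relabel_def distinct_map)
qed

text \<open>Relabelling conjugates the circuit by the basis permutation \<open>index_map\<close>; in
  the induction step the intermediate basis index is reindexed along this bijection.\<close>

lemma index_circuit_mat_relabel:
  assumes "set gs \<subseteq> gate_data g n" "i < 2 ^ n" "j < 2 ^ n"
  shows "circuit_mat n (map relabel gs) $$ (index_map i, index_map j) = circuit_mat n gs $$ (i, j)"
  using assms
proof (induction gs arbitrary: i)
  case Nil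
  then show ?case
    using index_map_less inj_onD[OF bij_betw_imp_inj_on[OF bij_betw_index_map], of i j] by auto
next
  case (Cons x gs)
  obtain qs V where x: "x = (qs, V)" by (cases x)
  have qs: "set qs \<subseteq> {..<n}" using Cons.prems(1) by (auto simp: x gate_data_def)
  let ?A = "apply_gate n (map \<pi> qs) V" and ?B = "circuit_mat n (map relabel gs)"
  have "circuit_mat n (map relabel (x # gs)) $$ (index_map i, index_map j)
      = (\<Sum>l<2 ^ n. ?A $$ (index_map i, l) * ?B $$ (l, index_map j))"
    using index_map_less by (simp add: x relabel_def
        index_mult_mat_sum[OF apply_gate_carrier circuit_mat_carrier] del: index_mult_mat)
  also have "\<dots> = (\<Sum>l<2 ^ n. ?A $$ (index_map i, index_map l) * ?B $$ (index_map l, index_map j))"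
    by (rule sum.reindex_bij_betw[OF bij_betw_index_map, symmetric])
  also have "\<dots> = (\<Sum>l<2 ^ n. apply_gate n qs V $$ (i, l) * circuit_mat n gs $$ (l, j))"
    using Cons qs by (intro sum.cong refl) (simp add: index_apply_gate_map)
  also have "\<dots> = circuit_mat n (x # gs) $$ (i, j)"
    using Cons.prems(2,3) by (simp add: x
        index_mult_mat_sum[OF apply_gate_carrier circuit_mat_carrier] del: index_mult_mat)
  finally show ?case .
qed

text \<open>An input index below 2^M has no digits beyond the fixed qubits and is itself fixed. The
  first m qubits are fixed too, so \<open>index_map\<close> only permutes indices within each
  outcome class.\<close>

lemma outcome_tuple_relabel:
  assumes fixed: "\<And>l. l < M \<Longrightarrow> \<pi> l = l" and "m \<le> M" "m \<le> n" "k \<le> 2 ^ M" "k \<le> 2 ^ n"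
    and gs: "set gs \<subseteq> gate_data g n"
  shows "outcome_tuple m n k (circuit_mat n (map relabel gs)) = outcome_tuple m n k (circuit_mat n gs)"
proof -
  let ?U = "circuit_mat n gs" and ?W = "circuit_mat n (map relabel gs)"
  have fix_index: "index_map j = j" if "j < k" for j
  proof (rule index_map_eqI)
    fix l assume l: "l < n"
    show "bit j (\<pi> l) \<longleftrightarrow> bit j l"
    proof (cases "l < M")
      case True
      then show ?thesis by (simp add: fixed)
    next
      case False
      \<comment> \<open>By injectivity no further qubit can land among the fixed ones, so both
        digits in question lie beyond M and vanish.\<close>
      have "\<not> \<pi> l < M"
      proof
        assume less: "\<pi> l < M"
        then have "\<pi> (\<pi> l) = \<pi> l" by (rule fixed)
        then have "\<pi> l = l" using inj_onD[OF perm_inj, of "\<pi> l" l] perm_less[OF l] l by simp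
        then show False using less False by simp
      qed
      moreover have "j < 2 ^ M" using that assms(4) by simp
      ultimately show ?thesis using False by (simp add: nat_less_exp_iff_bit)
    qed
  qed (use that assms(5) in simp)
  have fix_mod: "index_map i mod 2 ^ m = i mod 2 ^ m" for i
  proof -
    have "take_bit m (index_map i) = take_bit m i"
    proof (rule bit_eqI)
      fix l
      show "bit (take_bit m (index_map i)) l = bit (take_bit m i) l"
        using bit_index_map[of l i] fixed[of l] assms(2,3) by (auto simp: bit_take_bit_iff)
    qed
    then show ?thesis by (simp add: take_bit_eq_mod)
  qed
  have "outcome_prob m n (?W *\<^sub>v unit_vec (2 ^ n) j) c = outcome_prob m n (?U *\<^sub>v unit_vec (2 ^ n) j) c"
    if j: "j < k" and c: "c < 2 ^ m" for j c
  proof -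
    have j': "j < 2 ^ n" using j assms(5) by simp
    let ?f = "\<lambda>A i. if i mod 2 ^ m = c then (cmod (A $$ (i, j)))\<^sup>2 else 0"
    have outcome: "outcome_prob m n (A *\<^sub>v unit_vec (2 ^ n) j) c = (\<Sum>i<2 ^ n. ?f A i)"
      if A: "A \<in> carrier_mat (2 ^ n) (2 ^ n)" for A
      unfolding outcome_prob_eq[OF assms(3) c] using j'
      by (subst sum.inter_filter) (auto simp: index_mult_unit_vec[OF A] simp del: index_mult_mat_vec intro!: sum.cong)
    have "(\<Sum>i<2 ^ n. ?f ?W i) = (\<Sum>i<2 ^ n. ?f ?W (index_map i))"
      by (rule sum.reindex_bij_betw[OF bij_betw_index_map, symmetric])
    also have "\<dots> = (\<Sum>i<2 ^ n. ?f ?U i)"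
      using index_circuit_mat_relabel[OF gs _ j'] by (intro sum.cong) (auto simp: fix_index[OF j] fix_mod)
    finally show ?thesis by (simp add: outcome)
  qed
  then show ?thesis
    unfolding outcome_tuple_def by (intro restrict_ext) (auto simp: outcome_prob_def fun_eq_iff restrict_def)
qed

end

text \<open>At most b gates touch at most g b qubits. The first m + k qubits are kept fixed: they
  contain the measured ones and, because k < 2^k, all nonzero digits of the inputs. This removes n
  from the counting of qubit lists.\<close>

lemma ex_circuit_few_qubits:
  assumes gs: "set gs \<subseteq> gate_data g n" "length gs \<le> b" and "m \<le> n" "k \<le> 2 ^ n"
  shows "\<exists>hs. length hs \<le> b \<and> set hs \<subseteq> gate_data g n \<and>
    (\<forall>x\<in>set hs. set (fst x) \<subseteq> {..<m + k + g * b}) \<and>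
    outcome_tuple m n k (circuit_mat n hs) = outcome_tuple m n k (circuit_mat n gs)"
proof -
  define T where "T = (\<Union>x\<in>set gs. set (fst x))"
  have "card T \<le> (\<Sum>x\<in>set gs. card (set (fst x)))"
    unfolding T_def by (rule card_UN_le) simp
  also have "\<dots> \<le> (\<Sum>x\<in>set gs. g)"
  proof (rule sum_mono)
    fix x assume "x \<in> set gs"
    then have "length (fst x) = g" using gs(1) by (auto simp: gate_data_def)
    then show "card (set (fst x)) \<le> g" using card_length[of "fst x"] by simp
  qed
  also have "\<dots> \<le> g * b" using gs(2) card_length[of gs] by (simp add: mult.commute)
  finally have "card T \<le> g * b" .
  moreover have "T \<subseteq> {..<n}" using gs(1) by (fastforce simp: T_def gate_data_def)
  ultimately obtain \<pi> where \<pi>: "bij_betw \<pi> {..<n} {..<n}" "\<forall>l<m + k. \<pi> l = l" "\<pi> ` T \<subseteq> {..<m + k + g * b}"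
    using ex_bij_into_initial_segment[of T n "g * b" "m + k"] by blast
  interpret qubit_permutation n \<pi> by standard (rule \<pi>(1))
  have "k < 2 ^ k" by (rule less_exp)
  also have "(2::nat) ^ k \<le> 2 ^ (m + k)" by (rule power_increasing) auto
  finally have "outcome_tuple m n k (circuit_mat n (map relabel gs)) = outcome_tuple m n k (circuit_mat n gs)"
    using \<pi>(2) assms(3,4) gs(1) by (intro outcome_tuple_relabel[where M = "m + k"]) auto
  moreover have "set (map relabel gs) \<subseteq> gate_data g n"
    using gs(1) relabel_mem_gate_data by auto
  moreover have "\<forall>x\<in>set (map relabel gs). set (fst x) \<subseteq> {..<m + k + g * b}"
    using \<pi>(3) by (auto simp: T_def relabel_def)
  ultimately show ?thesis using gs(2) by (intro exI[of _ "map relabel gs"]) auto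
qed

section \<open>Nets of circuit outputs\<close>

text \<open>The cells of a grid of mesh 1/L that contain the real and imaginary parts of the
  entries. It is a code for gates that takes finitely many values on unitaries.\<close>

definition entry_cells :: "nat \<Rightarrow> nat \<Rightarrow> complex mat \<Rightarrow> nat \<times> nat \<Rightarrow> int \<times> int" where
  "entry_cells g L V = (\<lambda>(a, b)\<in>{..<2 ^ g} \<times> {..<2 ^ g}.
     (\<lfloor>real L * Re (V $$ (a, b))\<rfloor>, \<lfloor>real L * Im (V $$ (a, b))\<rfloor>))"

lemma floor_scaled_eq_imp_abs_diff_le:
  assumes "\<lfloor>real L * x\<rfloor> = \<lfloor>real L * y\<rfloor>" "1 \<le> L"
  shows "\<bar>x - y\<bar> \<le> 1 / real L"
proof -
  have "\<bar>real L * x - real L * y\<bar> \<le> 1" using assms(1) by linarith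
  then have "real L * \<bar>x - y\<bar> \<le> 1" by (simp add: abs_mult flip: right_diff_distrib)
  then show ?thesis using assms(2) by (simp add: field_simps)
qed

lemma close_gates_of_cells:
  assumes "fst x = fst y" "entry_cells g L (snd x) = entry_cells g L (snd y)" "1 \<le> L"
  shows "close_gates g (2 / real L) x y"
  unfolding close_gates_def
proof (intro conjI allI impI)
  fix a b :: nat assume ab: "a < 2 ^ g" "b < 2 ^ g"
  let ?z = "snd x $$ (a, b)" and ?w = "snd y $$ (a, b)"
  have "\<lfloor>real L * Re ?z\<rfloor> = \<lfloor>real L * Re ?w\<rfloor>" "\<lfloor>real L * Im ?z\<rfloor> = \<lfloor>real L * Im ?w\<rfloor>"
    using fun_cong[OF assms(2), of "(a, b)"] ab by (auto simp: entry_cells_def)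
  then have "\<bar>Re (?z - ?w)\<bar> \<le> 1 / real L" "\<bar>Im (?z - ?w)\<bar> \<le> 1 / real L"
    using assms(3) by (auto intro: floor_scaled_eq_imp_abs_diff_le)
  then show "cmod (?z - ?w) \<le> 2 / real L"
    using cmod_le[of "?z - ?w"] by simp
qed (rule assms(1))

lemma entry_cells_mem:
  assumes "V \<in> unitaries g"
  shows "entry_cells g L V \<in> {..<2 ^ g} \<times> {..<2 ^ g} \<rightarrow>\<^sub>E {- int L..int L} \<times> {- int L..int L}"
proof -
  have cell: "\<lfloor>real L * t\<rfloor> \<in> {- int L..int L}" if "\<bar>t\<bar> \<le> 1" for t
  proof -
    have "\<bar>real L * t\<bar> \<le> real L" using that by (simp add: abs_mult mult_left_le)
    then show ?thesis by (auto simp: le_floor_iff floor_le_iff)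
  qed
  have "\<bar>Re (V $$ (a, b))\<bar> \<le> 1" "\<bar>Im (V $$ (a, b))\<bar> \<le> 1" if "a < 2 ^ g" "b < 2 ^ g" for a b
    using unitary_entry_le[OF assms that] abs_Re_le_cmod[of "V $$ (a, b)"] abs_Im_le_cmod[of "V $$ (a, b)"]
    by linarith+
  then show ?thesis unfolding entry_cells_def using cell by (auto intro!: restrict_PiE_iff[THEN iffD2])
qed

text \<open>A circuit on few qubits is coded by its qubit lists and entry cells, and equal codes
  force nearby outputs. Per gate there are (m + k + g b)^g qubit lists and at most 2 L + 1 cells for
  each of the 2 * 4^g real coordinates; b + 1 counts the possible lengths.\<close>

lemma outcome_tuple_net:
  assumes "m \<le> n" "1 \<le> k" "k \<le> 2 ^ n" "1 \<le> L"
  shows "\<exists>Y. finite Y \<and> Y \<subseteq> outcome_tuple m n k ` circuits g b n \<and>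
    card Y \<le> (b + 1) * ((m + k + g * b) ^ g * (2 * L + 1) ^ (2 * 4 ^ g)) ^ b \<and>
    (\<forall>y\<in>outcome_tuple m n k ` circuits g b n.
      \<exists>y'\<in>Y. avg_tvd (2 ^ m) k y y' \<le> 4 * real b * 2 ^ g / real L)"
proof -
  define G where "G = {gs. length gs \<le> b \<and> set gs \<subseteq> gate_data g n \<and>
    (\<forall>x\<in>set gs. set (fst x) \<subseteq> {..<m + k + g * b})}"
  define Q where "Q = {qs :: nat list. set qs \<subseteq> {..<m + k + g * b} \<and> length qs = g}"
  define E where "E = ({..<2 ^ g :: nat} \<times> {..<2 ^ g :: nat} \<rightarrow>\<^sub>E {- int L..int L} \<times> {- int L..int L})"
  define C where "C = {cs. set cs \<subseteq> Q \<times> E \<and> length cs \<le> b}"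
  define D where "D = (m + k + g * b) ^ g * (2 * L + 1) ^ (2 * 4 ^ g)"
  define code where "code = map (\<lambda>x :: nat list \<times> complex mat. (fst x, entry_cells g L (snd x)))"
  define out where "out = (\<lambda>gs. outcome_tuple m n k (circuit_mat n gs))"
  have fin: "finite Q" "finite E"
    by (auto simp: Q_def E_def finite_lists_length_eq intro!: finite_PiE)
  then have finC: "finite C" unfolding C_def by (intro finite_lists_length_le) auto
  have "card Q = (m + k + g * b) ^ g" by (simp add: Q_def card_lists_length_eq)
  moreover have "card E = (2 * L + 1) ^ (2 * 4 ^ g)"
  proof -
    have "card E = ((2 * L + 1) * (2 * L + 1)) ^ (2 ^ g * 2 ^ g)"
    proof -
      have "card {- int L..int L} = 2 * L + 1" by simp
      then show ?thesis by (simp only: E_def card_PiE finite_cartesian_product finite_lessThan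
          prod_constant card_cartesian_product card_lessThan)
    qed
    also have "(2 * L + 1) * (2 * L + 1) = (2 * L + 1)\<^sup>2" by (simp add: power2_eq_square)
    also have "(2::nat) ^ g * 2 ^ g = 4 ^ g" by (simp flip: power_mult_distrib)
    finally show ?thesis by (simp only: power_mult)
  qed
  ultimately have "card (Q \<times> E) = D" by (simp add: D_def card_cartesian_product)
  then have "card C = (\<Sum>i\<le>b. D ^ i)"
    unfolding C_def using fin by (subst card_lists_length_le) auto
  \<comment> \<open>\<open>D\<close> is at least 1 because k is, so the longest codes
    dominate.\<close>
  also have "\<dots> \<le> (\<Sum>i\<le>b. D ^ b)"
    using assms(2) by (intro sum_mono power_increasing) (auto simp: D_def)
  finally have cardC: "card C \<le> (b + 1) * D ^ b" by simp
  have code: "code ` G \<subseteq> C"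
  proof (intro image_subsetI)
    fix gs assume gs: "gs \<in> G"
    have "(fst x, entry_cells g L (snd x)) \<in> Q \<times> E" if "x \<in> set gs" for x
    proof -
      have x: "x \<in> gate_data g n" "set (fst x) \<subseteq> {..<m + k + g * b}"
        using gs that by (auto simp: G_def)
      then have "fst x \<in> Q" by (auto simp: Q_def gate_data_def)
      moreover have "snd x \<in> unitaries g" using x(1) by (auto simp: gate_data_def)
      then have "entry_cells g L (snd x) \<in> E" unfolding E_def by (rule entry_cells_mem)
      ultimately show ?thesis by (rule SigmaI)
    qed
    then have "set (code gs) \<subseteq> Q \<times> E" unfolding code_def set_map by (rule image_subsetI)
    moreover have "length (code gs) \<le> b" using gs by (simp add: code_def G_def)
    ultimately show "code gs \<in> C" unfolding C_def by blast
  qed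
  \<comment> \<open>One genuine circuit is chosen for each attained code. The net points are then
    exact circuit outputs, hence tuples of distributions, as the Chernoff bound requires of its
    target.\<close>
  define Y where "Y = out ` inv_into G code ` code ` G"
  have fin_code: "finite (code ` G)" using finC code finite_subset by blast
  have "finite Y" unfolding Y_def by (intro finite_imageI fin_code)
  moreover have "card Y \<le> (b + 1) * D ^ b"
  proof -
    have "card Y \<le> card (inv_into G code ` code ` G)"
      unfolding Y_def using fin_code by (rule card_image_le[OF finite_imageI])
    also have "\<dots> \<le> card (code ` G)" using fin_code by (rule card_image_le)
    also have "\<dots> \<le> card C" using finC code by (rule card_mono)
    finally show ?thesis using cardC by (rule order_trans)
  qed
  moreover have "Y \<subseteq> outcome_tuple m n k ` circuits g b n"
  proof -
    have "inv_into G code ` code ` G \<subseteq> G" by (auto intro: inv_into_into)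
    moreover have "out ` G \<subseteq> outcome_tuple m n k ` circuits g b n"
      unfolding circuits_eq G_def out_def by blast
    ultimately show ?thesis unfolding Y_def by blast
  qed
  moreover have "\<exists>y'\<in>Y. avg_tvd (2 ^ m) k y y' \<le> 4 * real b * 2 ^ g / real L"
    if y: "y \<in> outcome_tuple m n k ` circuits g b n" for y
  proof -
    obtain gs0 where "set gs0 \<subseteq> gate_data g n" "length gs0 \<le> b" "y = out gs0"
      using y unfolding circuits_eq out_def by blast
    \<comment> \<open>The circuit is first replaced by one on few qubits with the same outputs,
      since only such circuits have codes in \<open>C\<close>.\<close>
    then obtain gs where gs: "gs \<in> G" "y = out gs"
      using ex_circuit_few_qubits[of gs0 g n b m k] assms unfolding out_def G_def by auto
    define hs where "hs = inv_into G code (code gs)"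
    have hs: "hs \<in> G" "code hs = code gs" "out hs \<in> Y"
      using gs(1) by (auto simp: hs_def Y_def intro: inv_into_into f_inv_into_f)
    have "length hs = length gs" using arg_cong[OF hs(2), of length] by (simp add: code_def)
    moreover have "close_gates g (2 / real L) (gs ! i) (hs ! i)" if "i < length gs" for i
      using arg_cong[OF hs(2), of "\<lambda>cs. cs ! i"] that calculation assms(4)
      by (intro close_gates_of_cells) (auto simp: code_def)
    ultimately have "list_all2 (close_gates g (2 / real L)) gs hs" by (simp add: list_all2_conv_all_nth)
    then have "avg_tvd (2 ^ m) k (out gs) (out hs) \<le> 2 * real (length gs) * 2 ^ g * (2 / real L)"
      unfolding out_def using gs(1) hs(1) assms by (intro avg_tvd_outcome_tuple_le) (auto simp: G_def)
    also have "\<dots> = 4 * real (length gs) * 2 ^ g / real L" by simp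
    also have "\<dots> \<le> 4 * real b * 2 ^ g / real L"
      using gs(1) by (intro divide_right_mono mult_right_mono mult_left_mono) (auto simp: G_def)
    finally show ?thesis using hs(3) gs(2) by blast
  qed
  ultimately show ?thesis unfolding D_def by blast
qed

section \<open>Union bound\<close>

lemma tvd_triangle: "tvd N x z \<le> tvd N x y + tvd N y z"
  unfolding tvd_def sum.distrib[symmetric] by (rule sum_mono) linarith

lemma avg_tvd_triangle: "avg_tvd N k x z \<le> avg_tvd N k x y + avg_tvd N k y z"
  unfolding avg_tvd_def add_divide_distrib[symmetric] sum.distrib[symmetric]
  by (intro divide_right_mono sum_mono tvd_triangle) simp

lemma outcome_tuple_circuits_mem:
  assumes "y \<in> outcome_tuple m n k ` circuits g b n" "m \<le> n" "k \<le> 2 ^ n" "i < k"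
  shows "y i \<in> prob_simplex (2 ^ m)"
proof -
  obtain gs where gs: "set gs \<subseteq> gate_data g n" "y = outcome_tuple m n k (circuit_mat n gs)"
    using assms(1) unfolding circuits_eq by blast
  have i: "i < 2 ^ n" using assms(3,4) by simp
  have "outcome_prob m n (circuit_mat n gs *\<^sub>v unit_vec (2 ^ n) i) \<in> prob_simplex (2 ^ m)"
    using assms(2) i
    by (intro outcome_prob_simplex mult_mat_vec_carrier[OF circuit_mat_carrier])
      (simp_all add: state_norm_circuit[OF gs(1)] state_norm_unit_vec)
  then show ?thesis using assms(4) by (simp add: gs(2) outcome_tuple_def)
qed

text \<open>No measurability of the set of approximable tuples is assumed: \<open>measure\<close> is \<open>0\<close> on
  non-measurable sets.\<close>
lemma measure_approximable_le:
  assumes "m \<le> n" "1 \<le> k" "k \<le> 2 ^ n" "1 \<le> L" "0 \<le> \<epsilon>" "\<epsilon> \<le> 3"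
    and d: "d + 4 * real b * 2 ^ g / real L \<le> 2 / exp 1 - \<epsilon>"
  shows "measure (uniform_sparse_simplex_tuples (2 ^ m) (2 ^ m) k) (approximable b g m n (2 ^ m) d k)
    \<le> real ((b + 1) * ((m + k + g * b) ^ g * (2 * L + 1) ^ (2 * 4 ^ g)) ^ b) *
      (exp 2 * 2 ^ m * exp (- (2 ^ m * \<epsilon>\<^sup>2 / 12))) ^ k"
    (is "measure ?M ?A \<le> real ?K * ?p")
proof (cases "?A \<in> sets ?M")
  case True
  obtain Y where Y: "finite Y" "Y \<subseteq> outcome_tuple m n k ` circuits g b n" "card Y \<le> ?K"
    "\<forall>y\<in>outcome_tuple m n k ` circuits g b n.
      \<exists>y'\<in>Y. avg_tvd (2 ^ m) k y y' \<le> 4 * real b * 2 ^ g / real L"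
    using outcome_tuple_net[OF assms(1-4), of g b] by blast
  define B where "B = (\<lambda>y. {x \<in> space ?M. avg_tvd (2 ^ m) k x y \<le> 2 / exp 1 - \<epsilon>})"
  note [measurable_cong] = sets_uniform_sparse_simplex_tuples[of "2 ^ m" k]
  have B: "B y \<in> sets ?M" for y unfolding B_def by measurable
  \<comment> \<open>Passing from a circuit output to its net point adds the net error to the radius,
    and hypothesis \<open>d\<close> keeps the total within 2/e - \<epsilon>.\<close>
  have "?A \<subseteq> (\<Union>y\<in>Y. B y)"
  proof
    fix x assume x: "x \<in> ?A"
    then obtain y where y: "y \<in> outcome_tuple m n k ` circuits g b n" "avg_tvd (2 ^ m) k x y \<le> d"
      by (auto simp: approximable_def)
    then obtain y' where y': "y' \<in> Y" "avg_tvd (2 ^ m) k y y' \<le> 4 * real b * 2 ^ g / real L"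
      using Y(4) by blast
    have "avg_tvd (2 ^ m) k x y' \<le> 2 / exp 1 - \<epsilon>"
      using avg_tvd_triangle[of "2 ^ m" k x y' y] y(2) y'(2) d by linarith
    then show "x \<in> (\<Union>y\<in>Y. B y)"
      using y'(1) x sets.sets_into_space[OF True] by (auto simp: B_def)
  qed
  then have "emeasure ?M ?A \<le> emeasure ?M (\<Union>y\<in>Y. B y)"
    using B Y(1) by (intro emeasure_mono) auto
  also have "\<dots> \<le> (\<Sum>y\<in>Y. emeasure ?M (B y))"
    using B Y(1) by (intro emeasure_subadditive_finite) auto
  also have "\<dots> \<le> (\<Sum>y\<in>Y. ennreal ?p)"
  proof (rule sum_mono)
    fix y assume "y \<in> Y"
    then have "\<And>i. i < k \<Longrightarrow> y i \<in> prob_simplex (2 ^ m)"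
      using Y(2) outcome_tuple_circuits_mem assms(1,3) by blast
    from emeasure_avg_tvd_le[OF _ assms(2,5,6) this] show "emeasure ?M (B y) \<le> ennreal ?p"
      by (simp add: B_def)
  qed
  also have "\<dots> = ennreal (real (card Y) * ?p)"
    by (simp add: ennreal_mult ennreal_of_nat_eq_real_of_nat)
  also have "\<dots> \<le> ennreal (real ?K * ?p)"
    using Y(3) by (intro ennreal_leI mult_right_mono) (simp_all only: of_nat_le_iff, simp)
  finally show ?thesis
    unfolding measure_def by (rule enn2real_leI[rotated]) simp
next
  case False
  then show ?thesis by (simp add: measure_notin_sets)
qed

text \<open>Puts the net size in the form exp (const * m k b). The exponent is linear in k, so the
  k-th power in the Chernoff bound can beat it. The constant collects 1 from b + 1, 2 + g for each
  of the g qubit positions of a gate, and 26 + g for each of its 2 * 4^g real coordinates. The grid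
  parameter L is 8 * 2^g * 4^m.\<close>

lemma net_size_le:
  assumes "1 \<le> m" "1 \<le> k" "b \<le> 2 ^ m"
  shows "real ((b + 1) * ((m + k + g * b) ^ g * (2 * (8 * 2 ^ g * 4 ^ m) + 1) ^ (2 * 4 ^ g)) ^ b)
    \<le> exp (real ((1 + g * (2 + g) + 2 * 4 ^ g * (26 + g)) * (m * k * b)))"
proof -
  have pow2: "(2::real) ^ j \<le> exp (real j)" for j
    using power_mono[of 2 "exp 1 :: real" j] exp_ge_add_one_self[of 1] by (simp flip: exp_of_nat_mult)
  have R: "real (m + k + g * b) \<le> exp (real ((2 + g) * (m * k)))"
  proof -
    have "real (m + k + g * b) \<le> real m + real k + real g * 2 ^ m"
      using assms(3) by (simp add: mult_left_mono)
    also have "\<dots> \<le> exp (real m) + real k * exp (real m) + real g * exp (real m)"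
    proof (intro add_mono mult_left_mono pow2)
      show "real m \<le> exp (real m)" using exp_ge_add_one_self[of "real m"] by linarith
      show "real k \<le> real k * exp (real m)" using mult_left_mono[of 1 "exp (real m)" "real k"] by simp
    qed simp
    also have "\<dots> \<le> exp (real m) * ((1 + real k) * (1 + real g))"
      by (simp add: algebra_simps)
    also have "\<dots> \<le> exp (real m) * (exp (real k) * exp (real g))"
      by (intro mult_mono exp_ge_add_one_self) auto
    also have "\<dots> = exp (real (m + k + g))" by (simp add: exp_add)
    also have "\<dots> \<le> exp (real ((2 + g) * (m * k)))"
    proof -
      have "m * 1 + 1 * k + g * 1 \<le> m * k + m * k + g * (m * k)"
        using assms by (intro add_mono mult_mono) auto
      then have "m + k + g \<le> (2 + g) * (m * k)" by (simp add: algebra_simps)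
      then show ?thesis by (simp only: exp_le_cancel_iff of_nat_le_iff)
    qed
    finally show ?thesis .
  qed
  have L: "real (2 * (8 * 2 ^ g * 4 ^ m) + 1) \<le> exp (real ((26 + g) * (m * k)))"
  proof -
    have one: "(1::real) \<le> 2 ^ g * 4 ^ m" using mult_mono[of 1 "2 ^ g :: real" 1 "4 ^ m"] by simp
    have "real (2 * (8 * 2 ^ g * 4 ^ m) + 1) \<le> 17 * (2 ^ g * 4 ^ m)" using one by simp
    also have "\<dots> \<le> 2 ^ 5 * (2 ^ g * 4 ^ m)" using one by (intro mult_right_mono) auto
    also have "\<dots> = 2 ^ (5 + g + 2 * m)" by (simp add: power_add power_mult)
    also have "\<dots> \<le> exp (real (5 + g + 2 * m))" by (rule pow2)
    also have "\<dots> \<le> exp (real ((26 + g) * (m * k)))"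
    proof -
      have "5 * 1 + g * 1 + 2 * (m * 1) \<le> 24 * (m * k) + g * (m * k) + 2 * (m * k)"
        using assms by (intro add_mono mult_mono) auto
      then have "5 + g + 2 * m \<le> (26 + g) * (m * k)" by (simp add: algebra_simps)
      then show ?thesis by (simp only: exp_le_cancel_iff of_nat_le_iff)
    qed
    finally show ?thesis .
  qed
  have b1: "real (b + 1) \<le> exp (real (m * k * b))"
  proof -
    have "real (b + 1) \<le> exp (real b)" using exp_ge_add_one_self[of "real b"] by simp
    also have "\<dots> \<le> exp (real (m * k * b))"
      using mult_mono[of 1 "m * k" b b] assms by (simp only: exp_le_cancel_iff of_nat_le_iff) simp
    finally show ?thesis .
  qed
  have "real ((b + 1) * ((m + k + g * b) ^ g * (2 * (8 * 2 ^ g * 4 ^ m) + 1) ^ (2 * 4 ^ g)) ^ b)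
      = real (b + 1) * (real (m + k + g * b) ^ g * real (2 * (8 * 2 ^ g * 4 ^ m) + 1) ^ (2 * 4 ^ g)) ^ b"
    by (simp only: of_nat_mult of_nat_power)
  also have "\<dots> \<le> exp (real (m * k * b)) *
      (exp (real ((2 + g) * (m * k))) ^ g * exp (real ((26 + g) * (m * k))) ^ (2 * 4 ^ g)) ^ b"
    by (intro mult_mono power_mono b1 R L mult_nonneg_nonneg zero_le_power) auto
  also have "\<dots> = exp (real ((1 + g * (2 + g) + 2 * 4 ^ g * (26 + g)) * (m * k * b)))"
    by (simp only: exp_of_nat_mult[symmetric] exp_add[symmetric] of_nat_mult[symmetric] of_nat_add[symmetric])
      (simp add: algebra_simps)
  finally show ?thesis .
qed

theorem corollary2p2:
  fixes \<alpha> :: real and g :: nat and n k :: "nat \<Rightarrow> nat"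
  assumes "0 < \<alpha>" and "\<alpha> < 1" and "1 \<le> g"
    and "\<And>m. 1 \<le> m \<Longrightarrow> g \<le> n m"
    and "\<And>m. 1 \<le> m \<Longrightarrow> m < n m"
    and "\<And>m. 1 \<le> m \<Longrightarrow> 1 \<le> k m"
    and "\<And>m. 1 \<le> m \<Longrightarrow> k m \<le> 2 ^ n m"
  shows "\<exists>\<eta> :: nat \<Rightarrow> real. \<eta> \<longlonglongrightarrow> 0 \<and>
    (\<lambda>m. measure (uniform_sparse_simplex_tuples (2 ^ m) (2 ^ m) (k m))
       (approximable (nat \<lfloor>2 powr (\<alpha> * real m * (1 - \<eta> m))\<rfloor>) g m (n m) (2 ^ m)
          (2 / exp 1 - 2 powr (- ((1 - \<alpha>) * real m / 2))) (k m))) \<longlonglongrightarrow> 0"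
proof -
  \<comment> \<open>With this choice b is at most 2^(\<alpha> m) / 2^(\<alpha> sqrt m). The divisor
    outgrows the factor m in the logarithm of the net size, although \<eta> tends to 0.\<close>
  define \<eta> :: "nat \<Rightarrow> real" where "\<eta> m = 1 / sqrt (real m)" for m
  define b where "b m = nat \<lfloor>2 powr (\<alpha> * real m * (1 - \<eta> m))\<rfloor>" for m
  define \<delta> where "\<delta> m = 2 powr (- ((1 - \<alpha>) * real m / 2))" for m :: nat
  define P where "P m = measure (uniform_sparse_simplex_tuples (2 ^ m) (2 ^ m) (k m))
    (approximable (b m) g m (n m) (2 ^ m) (2 / exp 1 - \<delta> m) (k m))" for m
  define c :: nat where "c = 1 + g * (2 + g) + 2 * 4 ^ g * (26 + g)"
  \<comment> \<open>The exponent per tuple component: c m b from the net, 2 + m from the prefactor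
    e^2 N of the Chernoff bound, and N (\<delta>/2)^2 / 12 = 2^(\<alpha> m) / 48 from its
    decay.\<close>
  define T where "T m = real c * (real m * 2 powr (\<alpha> * real m * (1 - \<eta> m))) + 2 + real m
    - 2 powr (\<alpha> * real m) / 48" for m
  have P_le: "P m \<le> exp (T m)" if m: "1 \<le> m" and T: "T m \<le> 0" for m
  proof -
    define N where "N = (2::real) ^ m"
    have N: "1 \<le> N" "0 < N" by (simp_all add: N_def)
    have N_powr: "N = 2 powr real m" by (simp add: N_def powr_realpow)
    have \<eta>: "0 \<le> \<eta> m" "\<eta> m \<le> 1" using m by (simp_all add: \<eta>_def)
    have b_le: "real (b m) \<le> 2 powr (\<alpha> * real m * (1 - \<eta> m))" by (simp add: b_def)
    also have "\<dots> \<le> 2 powr real m"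
    proof -
      have "\<alpha> * real m * (1 - \<eta> m) \<le> 1 * real m * 1"
        using assms(1,2) \<eta> by (intro mult_mono) auto
      then show ?thesis by simp
    qed
    finally have bN: "real (b m) \<le> N" by (simp add: N_powr)
    then have b2: "b m \<le> 2 ^ m" unfolding N_def by (metis of_nat_le_iff of_nat_numeral of_nat_power)
    \<comment> \<open>The exponent (1 - \<alpha>) / 2 in \<delta> is what makes N \<delta>^2 equal
      to N^\<alpha>, the scale of the gate count.\<close>
    have \<delta>2: "N * (\<delta> m)\<^sup>2 = 2 powr (\<alpha> * real m)"
      unfolding N_powr \<delta>_def power2_eq_square powr_add[symmetric] by (simp add: algebra_simps)
    have \<delta>: "0 < \<delta> m" by (simp add: \<delta>_def)
    have "\<delta> m \<le> 2 powr 0"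
      unfolding \<delta>_def using assms(2) by (intro powr_mono) auto
    then have \<delta>1: "\<delta> m \<le> 1" by simp
    have \<delta>N: "1 / N \<le> \<delta> m"
    proof -
      have "1 / N = 2 powr - real m" by (simp add: N_powr powr_minus divide_inverse)
      also have "\<dots> \<le> \<delta> m"
      proof -
        have "(1 - \<alpha>) * real m \<le> 1 * real m" using assms(1) by (intro mult_right_mono) auto
        then have "- real m \<le> - ((1 - \<alpha>) * real m / 2)" using m by linarith
        then show ?thesis unfolding \<delta>_def by simp
      qed
      finally show ?thesis .
    qed
    \<comment> \<open>As b \<le> N, this L makes the net error at most 1 / (2 N), hence at most
      \<delta>/2. The other half of \<delta> remains as \<epsilon> in the Chernoff bound.\<close>
    let ?L = "8 * 2 ^ g * 4 ^ m :: nat"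
    have "4 * real (b m) * 2 ^ g / real ?L \<le> 4 * N * 2 ^ g / real ?L"
      using bN by (intro divide_right_mono mult_right_mono mult_left_mono) auto
    also have "\<dots> = (1 / N) / 2"
    proof -
      have "real ?L = 8 * 2 ^ g * N\<^sup>2"
        by (simp add: N_def power2_eq_square flip: power_mult_distrib)
      then show ?thesis using N by (simp add: power2_eq_square)
    qed
    also have "\<dots> \<le> \<delta> m / 2" using \<delta>N by simp
    finally have "4 * real (b m) * 2 ^ g / real ?L \<le> \<delta> m / 2" .
    then have "2 / exp 1 - \<delta> m + 4 * real (b m) * 2 ^ g / real ?L \<le> 2 / exp 1 - \<delta> m / 2"
      by linarith
    then have "P m \<le> real ((b m + 1) * ((m + k m + g * b m) ^ g * (2 * ?L + 1) ^ (2 * 4 ^ g)) ^ b m) *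
        (exp 2 * 2 ^ m * exp (- (2 ^ m * (\<delta> m / 2)\<^sup>2 / 12))) ^ k m"
      unfolding P_def using assms(5-7)[OF m] \<delta> \<delta>1 by (intro measure_approximable_le) auto
    also have "\<dots> \<le> exp (real (c * (m * k m * b m))) * exp (2 + real m - 2 powr (\<alpha> * real m) / 48) ^ k m"
    proof (intro mult_mono power_mono)
      show "real ((b m + 1) * ((m + k m + g * b m) ^ g * (2 * ?L + 1) ^ (2 * 4 ^ g)) ^ b m)
          \<le> exp (real (c * (m * k m * b m)))"
        unfolding c_def by (rule net_size_le[OF m assms(6)[OF m] b2])
      have "(2::real) ^ m \<le> exp 1 ^ m" using exp_ge_add_one_self[of 1] by (intro power_mono) auto
      then have "exp 2 * 2 ^ m * exp (- (2 ^ m * (\<delta> m / 2)\<^sup>2 / 12))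
          \<le> exp 2 * exp (real m) * exp (- (2 ^ m * (\<delta> m / 2)\<^sup>2 / 12))"
        by (intro mult_right_mono mult_left_mono) (simp_all flip: exp_of_nat_mult)
      also have "\<dots> = exp (2 + real m - 2 powr (\<alpha> * real m) / 48)"
      proof -
        have "2 ^ m * (\<delta> m / 2)\<^sup>2 / 12 = 2 powr (\<alpha> * real m) / 48"
          using \<delta>2 by (simp add: N_def power_divide)
        then show ?thesis by (simp flip: exp_add)
      qed
      finally show "exp 2 * 2 ^ m * exp (- (2 ^ m * (\<delta> m / 2)\<^sup>2 / 12))
          \<le> exp (2 + real m - 2 powr (\<alpha> * real m) / 48)" .
    qed auto
    also have "\<dots> = exp (real (k m) * (real c * (real m * real (b m)) + 2 + real m - 2 powr (\<alpha> * real m) / 48))"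
      by (simp add: algebra_simps flip: exp_of_nat_mult exp_add)
    also have "\<dots> \<le> exp (real (k m) * T m)"
      unfolding T_def exp_le_cancel_iff using b_le
      by (intro mult_left_mono add_mono diff_mono order_refl) auto
    \<comment> \<open>Since T m \<le> 0 and k m \<ge> 1, larger tuples only improve the bound, so no
      growth condition on k enters.\<close>
    also have "\<dots> \<le> exp (1 * T m)"
      unfolding exp_le_cancel_iff using T assms(6)[OF m] by (intro mult_right_mono_neg) auto
    finally show ?thesis by simp
  qed
  have T: "filterlim T at_bot sequentially"
    unfolding T_def \<eta>_def using assms(1) by real_asymp
  then have "\<forall>\<^sub>F m in sequentially. T m \<le> 0"
    by (simp add: filterlim_at_bot)
  then have "\<forall>\<^sub>F m in sequentially. P m \<le> exp (T m)"
    using eventually_ge_at_top[of 1] by eventually_elim (rule P_le)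
  moreover have "(\<lambda>m. exp (T m)) \<longlonglongrightarrow> 0"
    using T by (rule filterlim_compose[OF exp_at_bot])
  ultimately have "P \<longlonglongrightarrow> 0"
    by (rule tendsto_sandwich[OF _ _ tendsto_const, rotated]) (simp add: P_def)
  moreover have "\<eta> \<longlonglongrightarrow> 0" unfolding \<eta>_def by real_asymp
  ultimately show ?thesis unfolding P_def b_def \<delta>_def by blast
qed

end
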